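(* Let $m$ be a positive integer and $\vartheta\in\mathbb{C}$. Let $r_1,r_2\in\mathbb{C}$ be such that $\vartheta-(\mathtt{h}+1)^2=-(\mathtt{h}-r_1)(\mathtt{h}-r_2)$, and choose $\omega\in\mathbb{R}$ strictly larger than the real parts of $r_1$ and $r_2$. Let $\boldsymbol{\zeta}\in\Psi^{(m)}$ and $\beta=g_{\boldsymbol{\zeta}}$ be such that the $R$-module $N_\beta=R/R(x^m-\beta)$ is simple, let $v_j=x^j+R(x^m-\beta)$ for $j=0,\dots,m-1$, and let $L_\beta$ be the (simple) socle of $N_\beta$ regarded as an $\mathfrak{sl}_2$-module. Then $L_\beta$ is spanned, as a vector space over $\mathbb{C}$, by the following linearly independent elements: (a) $\mathtt{h}^iv_j$, where $i\in\mathbb{Z}_{\ge 0}$ and $j\in\{0,1,\dots,m-1\}$; (b) $\frac{1}{(\mathtt{h}-\lambda-2mi-2j)^k}\cdot v_j$, where $j\in\{0,1,\dots,m-1\}$, $i\in\mathbb{Z}_{\ge0}$ and $1\le k\le-\mathtt{m}(\lambda)$, for each $\lambda\in\Omega_\omega^{(m)}$ such that $\mathtt{m}(\lambda)<0$; (c) $\frac{1}{(\mathtt{h}-\lambda+2mi+2(m-j))^k}\cdot v_j$, where $j\in\{0,1,\dots,m-1\}$, $i\in\mathbb{Z}_{\ge0}$ and $$1\le k\le \mathtt{m}(\lambda)-\bigl|\{s\in\{1,2\}: r_s\in\{\lambda-2,\lambda-4,\dots,\lambda-2mi-2(m-j)\}\}\bigr|,$$ for each $\lambda\in\Omega_\omega^{(m)}$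 such that $\mathtt{m}(\lambda)>0$.
   Context: $R=\mathbb{C}(\mathtt{h})[x,x^{-1},\sigma]$ is the skew Laurent polynomial algebra: the free left $\mathbb{C}(\mathtt{h})$-module with basis $x^i$, $i\in\mathbb{Z}$, with $x^ix^j=x^{i+j}$ and $xa=\sigma(a)x$ for $a\in\mathbb{C}(\mathtt{h})$, where $\sigma$ is the $\mathbb{C}$-automorphism of $\mathbb{C}(\mathtt{h})$ with $\sigma(\mathtt{h})=\mathtt{h}-2$. $\mathfrak{sl}_2$ is the complex Lie algebra with basis $\mathtt{e},\mathtt{f},\mathtt{h}$ and brackets $[\mathtt{h},\mathtt{e}]=2\mathtt{e}$, $[\mathtt{h},\mathtt{f}]=-2\mathtt{f}$, $[\mathtt{e},\mathtt{f}]=\mathtt{h}$. With $\mathtt{c}=(\mathtt{h}+1)^2+4\mathtt{f}\mathtt{e}$ and $U_\vartheta:=U(\mathfrak{sl}_2)/U(\mathfrak{sl}_2)(\mathtt{c}-\vartheta)$, an $R$-module is regarded as an $\mathfrak{sl}_2$-module via the injective algebra homomorphism $U_\vartheta\to R$, $\mathtt{e}\mapsto x$, $\mathtt{f}\mapsto\frac{\vartheta-(\mathtt{h}+1)^2}{4}x^{-1}$, $\mathtt{h}\mapsto\mathtt{h}$. It is known (Block) that a simple $R$-module has simple socle as a $U_\vartheta$-module. $\Omega_\omega$ is the set of complex numbers with real part in $[\omega,\omega+2)$ and $\Omega_\omega^{(m)}$ the set of those with real part in $[\omega,\omega+2m)$. $\Psi^{(m)}$ is the set of tuples $\boldsymbol{\zeta}=(c,\zeta_0,\dots,\zeta_{m-1})$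 with $c\in\mathbb{C}^\times$ and each $\zeta_i:\Omega_\omega\to\mathbb{Z}$ a function with finite support, and $$g_{\boldsymbol{\zeta}}(\mathtt{h})=c\prod_{i=0}^{m-1}\prod_{\lambda\in\Omega_\omega}(\mathtt{h}-\lambda-2i)^{\zeta_i(\lambda)}.$$ The function $\mathtt{m}:\Omega_\omega^{(m)}\to\mathbb{Z}$ is defined by $\beta=c\prod_{\lambda\in\Omega_\omega^{(m)}}(\mathtt{h}-\lambda)^{\mathtt{m}(\lambda)}$. *)

theory Defs
  imports
    "HOL-Library.Poly_Mapping"
    "HOL-Computational_Algebra.Normalized_Fraction"
    "HOL-Computational_Algebra.Polynomial_Factorial"
    "HOL-Computational_Algebra.Field_as_Ring"
    "HOL-Algebra.Ideal"
    "HOL-Algebra.AbelCoset"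
    "Jordan_Normal_Form.VS_Connect"
begin

section \<open>The field \<open>\<complex>(h)\<close> and its automorphism \<open>\<sigma>\<close>\<close>

type_synonym ratfun = "complex poly fract"

definition ratC :: "complex \<Rightarrow> ratfun"
  where "ratC c = Fraction_Field.Fract [:c:] 1"

definition ratH :: ratfun
  where "ratH = Fraction_Field.Fract [:0, 1:] 1"

text \<open>\<open>shift a\<close> is the substitution \<open>h \<mapsto> h - a\<close>. The automorphism \<open>\<sigma>\<close> is \<open>shift 2\<close>, and
  \<open>\<sigma>\<^sup>i\<close> is \<open>shift (2 i)\<close> for every integer \<open>i\<close>; see \<open>sigma_pow\<close> below.\<close>

definition shift :: "complex \<Rightarrow> ratfun \<Rightarrow> ratfun"
  where "shift a q = (case quot_of_fract q of (u, v) \<Rightarrow>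
    Fraction_Field.Fract (pcompose u [:- a, 1:]) (pcompose v [:- a, 1:]))"

abbreviation sigma :: "ratfun \<Rightarrow> ratfun"
  where "sigma \<equiv> shift 2"

lemma pcompose_linear_eq_0_iff: "pcompose u [:- a, 1:] = 0 \<longleftrightarrow> u = (0 :: complex poly)"
  by (auto simp: pcompose_eq_0_iff)

lemma shift_Fract:
  "shift a (Fraction_Field.Fract u v)
     = Fraction_Field.Fract (pcompose u [:- a, 1:]) (pcompose v [:- a, 1:])"
proof (cases "v = 0")
  case True
  then show ?thesis
    by (simp add: shift_def fract_collapse)
next
  case False
  obtain u' v' where q: "quot_of_fract (Fraction_Field.Fract u v) = (u', v')"
    by (cases "quot_of_fract (Fraction_Field.Fract u v)")
  have v': "v' \<noteq> 0"
    using snd_quot_of_fract_nonzero[of "Fraction_Field.Fract u v"] by (simp add: q)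
  have "quot_to_fract (u', v') = Fraction_Field.Fract u v"
    using quot_to_fract_quot_of_fract[of "Fraction_Field.Fract u v"] by (simp add: q)
  then have "u * v' = u' * v"
    using False v' by (simp add: quot_to_fract_def eq_fract)
  then have "pcompose u [:- a, 1:] * pcompose v' [:- a, 1:] = pcompose u' [:- a, 1:] * pcompose v [:- a, 1:]"
    by (metis pcompose_mult)
  then show ?thesis
    using False v' by (simp add: shift_def q eq_fract pcompose_linear_eq_0_iff)
qed

lemma shift_ratC [simp]: "shift a (ratC c) = ratC c"
  by (simp add: ratC_def shift_Fract pcompose_1)

lemma shift_ratH: "shift a ratH = ratH - ratC a"
  by (simp add: ratC_def ratH_def shift_Fract pcompose_pCons pcompose_1)

lemma shift_add: "shift a (p + q) = shift a p + shift a q"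
  by (cases p; cases q) (simp add: shift_Fract pcompose_add pcompose_mult pcompose_linear_eq_0_iff)

lemma shift_mult: "shift a (p * q) = shift a p * shift a q"
  by (cases p; cases q) (simp add: shift_Fract pcompose_mult)

lemma shift_0 [simp]: "shift a 0 = 0"
  by (simp add: Zero_fract_def shift_Fract pcompose_1)

lemma shift_1 [simp]: "shift a 1 = 1"
  by (simp add: One_fract_def shift_Fract pcompose_1)

lemma shift_shift: "shift a (shift b p) = shift (a + b) p"
  by (cases p) (simp add: shift_Fract flip: pcompose_assoc, simp add: pcompose_pCons algebra_simps)

lemma shift_by_0: "shift 0 p = p"
  by (cases p) (simp add: shift_Fract)

lemma bij_sigma: "bij sigma"
  by (rule o_bij[of "shift (- 2)"]) (auto simp: fun_eq_iff shift_shift shift_by_0)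

lemma sigma_pow: "(sigma ^^ n) p = shift (2 * of_nat n) p"
  "(inv_into UNIV sigma ^^ n) p = shift (- 2 * of_nat n) p"
proof -
  show "(sigma ^^ n) p = shift (2 * of_nat n) p"
    by (induction n) (simp_all add: shift_by_0 shift_shift algebra_simps)
  have "inv_into UNIV sigma = shift (- 2)"
    by (rule inv_unique_comp) (auto simp: fun_eq_iff shift_shift shift_by_0)
  then show "(inv_into UNIV sigma ^^ n) p = shift (- 2 * of_nat n) p"
    by (induction n) (simp_all add: shift_by_0 shift_shift algebra_simps)
qed


section \<open>The skew Laurent polynomial ring \<open>R\<close>\<close>

text \<open>The monomial \<open>a x\<^sup>i\<close> is \<open>single i a\<close>, and \<open>(a x\<^sup>i) (b x\<^sup>j) = a \<sigma>\<^sup>i(b) x\<^sup>i\<^sup>+\<^sup>j\<close>.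
  The product that type \<^typ>\<open>int \<Rightarrow>\<^sub>0 ratfun\<close> already carries is the commutative one and is not used.\<close>

definition skew_mult :: "(int \<Rightarrow>\<^sub>0 ratfun) \<Rightarrow> (int \<Rightarrow>\<^sub>0 ratfun) \<Rightarrow> (int \<Rightarrow>\<^sub>0 ratfun)"
  where "skew_mult p q =
    (\<Sum>i\<in>Poly_Mapping.keys p. \<Sum>j\<in>Poly_Mapping.keys q.
       Poly_Mapping.single (i + j)
         (Poly_Mapping.lookup p i * shift (2 * of_int i) (Poly_Mapping.lookup q j)))"

definition skew_laurent :: "(int \<Rightarrow>\<^sub>0 ratfun) ring"
  where "skew_laurent =
    \<lparr>carrier = UNIV, mult = skew_mult, one = Poly_Mapping.single 0 1, zero = 0, add = (+)\<rparr>"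

definition xpow :: "int \<Rightarrow> (int \<Rightarrow>\<^sub>0 ratfun)"
  where "xpow i = Poly_Mapping.single i 1"

definition coef :: "ratfun \<Rightarrow> (int \<Rightarrow>\<^sub>0 ratfun)"
  where "coef a = Poly_Mapping.single 0 a"

lemma skew_mult_superset:
  assumes "finite A" "finite B" "Poly_Mapping.keys p \<subseteq> A" "Poly_Mapping.keys q \<subseteq> B"
  shows "skew_mult p q =
    (\<Sum>i\<in>A. \<Sum>j\<in>B. Poly_Mapping.single (i + j)
         (Poly_Mapping.lookup p i * shift (2 * of_int i) (Poly_Mapping.lookup q j)))"
  unfolding skew_mult_def
proof (rule sum.mono_neutral_cong_left)
  show "finite A" "Poly_Mapping.keys p \<subseteq> A" by fact+
  show "\<forall>i\<in>A - Poly_Mapping.keys p.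
      (\<Sum>j\<in>B. Poly_Mapping.single (i + j)
         (Poly_Mapping.lookup p i * shift (2 * of_int i) (Poly_Mapping.lookup q j))) = 0"
    by (auto simp: in_keys_iff)
  fix i
  show "(\<Sum>j\<in>Poly_Mapping.keys q. Poly_Mapping.single (i + j)
         (Poly_Mapping.lookup p i * shift (2 * of_int i) (Poly_Mapping.lookup q j)))
      = (\<Sum>j\<in>B. Poly_Mapping.single (i + j)
         (Poly_Mapping.lookup p i * shift (2 * of_int i) (Poly_Mapping.lookup q j)))"
    by (rule sum.mono_neutral_left) (use assms in \<open>auto simp: in_keys_iff\<close>)
qed

lemma skew_mult_add_left: "skew_mult (p + p') q = skew_mult p q + skew_mult p' q"
proof -
  let ?A = "Poly_Mapping.keys p \<union> Poly_Mapping.keys p'" and ?B = "Poly_Mapping.keys q"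
  have "Poly_Mapping.keys (p + p') \<subseteq> ?A" by (rule Poly_Mapping.keys_add)
  then have "skew_mult (p + p') q = (\<Sum>i\<in>?A. \<Sum>j\<in>?B. Poly_Mapping.single (i + j)
         (Poly_Mapping.lookup (p + p') i * shift (2 * of_int i) (Poly_Mapping.lookup q j)))"
    by (intro skew_mult_superset) simp_all
  moreover have "skew_mult p q = (\<Sum>i\<in>?A. \<Sum>j\<in>?B. Poly_Mapping.single (i + j)
         (Poly_Mapping.lookup p i * shift (2 * of_int i) (Poly_Mapping.lookup q j)))"
    by (intro skew_mult_superset) simp_all
  moreover have "skew_mult p' q = (\<Sum>i\<in>?A. \<Sum>j\<in>?B. Poly_Mapping.single (i + j)
         (Poly_Mapping.lookup p' i * shift (2 * of_int i) (Poly_Mapping.lookup q j)))"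
    by (intro skew_mult_superset) simp_all
  ultimately show ?thesis
    by (simp only: lookup_add single_add distrib_right sum.distrib)
qed

lemma skew_mult_add_right: "skew_mult p (q + q') = skew_mult p q + skew_mult p q'"
proof -
  let ?A = "Poly_Mapping.keys p" and ?B = "Poly_Mapping.keys q \<union> Poly_Mapping.keys q'"
  have "Poly_Mapping.keys (q + q') \<subseteq> ?B" by (rule Poly_Mapping.keys_add)
  then have "skew_mult p (q + q') = (\<Sum>i\<in>?A. \<Sum>j\<in>?B. Poly_Mapping.single (i + j)
         (Poly_Mapping.lookup p i * shift (2 * of_int i) (Poly_Mapping.lookup (q + q') j)))"
    by (intro skew_mult_superset) simp_all
  moreover have "skew_mult p q = (\<Sum>i\<in>?A. \<Sum>j\<in>?B. Poly_Mapping.single (i + j)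
         (Poly_Mapping.lookup p i * shift (2 * of_int i) (Poly_Mapping.lookup q j)))"
    by (intro skew_mult_superset) simp_all
  moreover have "skew_mult p q' = (\<Sum>i\<in>?A. \<Sum>j\<in>?B. Poly_Mapping.single (i + j)
         (Poly_Mapping.lookup p i * shift (2 * of_int i) (Poly_Mapping.lookup q' j)))"
    by (intro skew_mult_superset) simp_all
  ultimately show ?thesis
    by (simp only: lookup_add single_add shift_add distrib_left sum.distrib)
qed

lemma skew_mult_single:
  "skew_mult (Poly_Mapping.single i a) (Poly_Mapping.single j b)
     = Poly_Mapping.single (i + j) (a * shift (2 * of_int i) b)"
  by (subst skew_mult_superset[where A = "{i}" and B = "{j}"]) auto

lemma skew_mult_0 [simp]: "skew_mult 0 q = 0" "skew_mult p 0 = 0"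
  by (simp_all add: skew_mult_def)

lemma poly_mapping_single_induct:
  assumes "P 0" "\<And>i a p. P p \<Longrightarrow> P (Poly_Mapping.single i a + p)"
  shows "P (p :: int \<Rightarrow>\<^sub>0 ratfun)"
proof (induction p rule: update_induct)
  case const
  then show ?case by (rule assms(1))
next
  case (update f a b)
  have "Poly_Mapping.update a b f = Poly_Mapping.single a b + f"
    using update(1)
    by (intro poly_mapping_eqI) (auto simp: lookup_update lookup_add lookup_single in_keys_iff when_def)
  then show ?case using assms(2) update by simp
qed

lemma skew_mult_assoc: "skew_mult (skew_mult p q) r = skew_mult p (skew_mult q r)"
proof -
  have 1: "skew_mult (skew_mult (Poly_Mapping.single i a) (Poly_Mapping.single j b)) r
      = skew_mult (Poly_Mapping.single i a) (skew_mult (Poly_Mapping.single j b) r)" for i j a b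
    by (induction r rule: poly_mapping_single_induct)
       (auto simp: skew_mult_add_right skew_mult_single shift_mult shift_shift algebra_simps)
  have 2: "skew_mult (skew_mult (Poly_Mapping.single i a) q) r
      = skew_mult (Poly_Mapping.single i a) (skew_mult q r)" for i a
    by (induction q rule: poly_mapping_single_induct)
       (auto simp: skew_mult_add_right skew_mult_add_left 1)
  show ?thesis
    by (induction p rule: poly_mapping_single_induct)
       (auto simp: skew_mult_add_left 2)
qed

lemma skew_mult_one_left: "skew_mult (Poly_Mapping.single 0 1) p = p"
  by (induction p rule: poly_mapping_single_induct)
     (auto simp: skew_mult_add_right skew_mult_single shift_by_0 simp del: single_one)

lemma skew_mult_one_right: "skew_mult p (Poly_Mapping.single 0 1) = p"
  by (induction p rule: poly_mapping_single_induct)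
     (auto simp: skew_mult_add_left skew_mult_single simp del: single_one)

lemma skew_laurent_simps [simp]:
  "carrier skew_laurent = UNIV" "mult skew_laurent = skew_mult"
  "one skew_laurent = Poly_Mapping.single 0 1" "zero skew_laurent = 0" "add skew_laurent = (+)"
  by (simp_all add: skew_laurent_def)

lemma ring_skew_laurent: "ring skew_laurent"
proof (rule ringI)
  show "abelian_group skew_laurent"
  proof (rule abelian_groupI, unfold skew_laurent_simps)
    fix x y z :: "int \<Rightarrow>\<^sub>0 ratfun"
    show "x + y \<in> UNIV" "0 \<in> (UNIV :: (int \<Rightarrow>\<^sub>0 ratfun) set)" by (rule UNIV_I)+
    show "x + y + z = x + (y + z)" "x + y = y + x" "0 + x = x" by (rule add.assoc add.commute add_0)+
    show "\<exists>y\<in>UNIV. y + x = 0" by (rule bexI[of _ "- x"]) (rule left_minus UNIV_I)+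
  qed
  show "Group.monoid skew_laurent"
    by (rule monoidI; unfold skew_laurent_simps;
        rule UNIV_I skew_mult_assoc skew_mult_one_left skew_mult_one_right)
  fix x y z
  show "(x \<oplus>\<^bsub>skew_laurent\<^esub> y) \<otimes>\<^bsub>skew_laurent\<^esub> z
      = x \<otimes>\<^bsub>skew_laurent\<^esub> z \<oplus>\<^bsub>skew_laurent\<^esub> y \<otimes>\<^bsub>skew_laurent\<^esub> z"
    "z \<otimes>\<^bsub>skew_laurent\<^esub> (x \<oplus>\<^bsub>skew_laurent\<^esub> y)
      = z \<otimes>\<^bsub>skew_laurent\<^esub> x \<oplus>\<^bsub>skew_laurent\<^esub> z \<otimes>\<^bsub>skew_laurent\<^esub> y"
    by (simp_all only: skew_laurent_simps skew_mult_add_left skew_mult_add_right)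
qed

lemma xpow_coef: "xpow 1 \<otimes>\<^bsub>skew_laurent\<^esub> coef a = coef (sigma a) \<otimes>\<^bsub>skew_laurent\<^esub> xpow 1"
  by (simp add: xpow_def coef_def skew_mult_single shift_by_0)

lemma xpow_xpow: "xpow i \<otimes>\<^bsub>skew_laurent\<^esub> xpow j = xpow (i + j)"
  by (simp add: xpow_def skew_mult_single)


section \<open>Left modules\<close>

text \<open>The library locale \<^locale>\<open>module\<close> requires a commutative ring of scalars.\<close>

locale left_module = R?: ring R + M?: abelian_group M
  for R :: "('a, 'b) ring_scheme" (structure) and M :: "('a, 'c, 'd) module_scheme" (structure) +
  assumes smult_closed:
      "\<lbrakk>a \<in> carrier R; x \<in> carrier M\<rbrakk> \<Longrightarrow> a \<odot>\<^bsub>M\<^esub> x \<in> carrier M"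
    and smult_l_distr:
      "\<lbrakk>a \<in> carrier R; b \<in> carrier R; x \<in> carrier M\<rbrakk>
        \<Longrightarrow> (a \<oplus> b) \<odot>\<^bsub>M\<^esub> x = a \<odot>\<^bsub>M\<^esub> x \<oplus>\<^bsub>M\<^esub> b \<odot>\<^bsub>M\<^esub> x"
    and smult_r_distr:
      "\<lbrakk>a \<in> carrier R; x \<in> carrier M; y \<in> carrier M\<rbrakk>
        \<Longrightarrow> a \<odot>\<^bsub>M\<^esub> (x \<oplus>\<^bsub>M\<^esub> y) = a \<odot>\<^bsub>M\<^esub> x \<oplus>\<^bsub>M\<^esub> a \<odot>\<^bsub>M\<^esub> y"
    and smult_assoc1:
      "\<lbrakk>a \<in> carrier R; b \<in> carrier R; x \<in> carrier M\<rbrakk>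
        \<Longrightarrow> (a \<otimes> b) \<odot>\<^bsub>M\<^esub> x = a \<odot>\<^bsub>M\<^esub> (b \<odot>\<^bsub>M\<^esub> x)"
    and smult_one:
      "x \<in> carrier M \<Longrightarrow> \<one> \<odot>\<^bsub>M\<^esub> x = x"

definition simple_left_module :: "('a, 'b) ring_scheme \<Rightarrow> ('a, 'c, 'd) module_scheme \<Rightarrow> bool"
  where "simple_left_module R M \<longleftrightarrow>
    left_module R M \<and> carrier M \<noteq> {\<zero>\<^bsub>M\<^esub>} \<and>
    (\<forall>H. Module.submodule H R M \<longrightarrow> H = {\<zero>\<^bsub>M\<^esub>} \<or> H = carrier M)"

text \<open>The quotient \<open>R / I\<close> by a left ideal \<open>I\<close>: elements are the cosets \<open>I + r\<close>, and \<open>s\<close> sends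
  \<open>I + r\<close> to \<open>I + s r\<close>. The fields \<open>mult\<close> and \<open>one\<close> of the record play no role in a module.\<close>

definition left_quotient :: "('a, 'b) ring_scheme \<Rightarrow> 'a set \<Rightarrow> ('a, 'a set) module"
  where "left_quotient R I =
    \<lparr>carrier = a_rcosets\<^bsub>R\<^esub> I, mult = undefined, one = undefined,
     zero = I, add = (<+>\<^bsub>R\<^esub>),
     smult = (\<lambda>s C. \<Union>r\<in>C. I +>\<^bsub>R\<^esub> (s \<otimes>\<^bsub>R\<^esub> r))\<rparr>"

definition restrict_scalars :: "('k \<Rightarrow> 'a) \<Rightarrow> ('a, 'c) module \<Rightarrow> ('k, 'c) module"
  where "restrict_scalars \<phi> M =
    \<lparr>carrier = carrier M, mult = mult M, one = one M, zero = zero M, add = add M,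
     smult = (\<lambda>c. smult M (\<phi> c))\<rparr>"

lemma left_quotient_smult:
  assumes R: "ring R" and I: "additive_subgroup I R"
    and left: "\<And>s r. s \<in> carrier R \<Longrightarrow> r \<in> I \<Longrightarrow> s \<otimes>\<^bsub>R\<^esub> r \<in> I"
    and s: "s \<in> carrier R" and r: "r \<in> carrier R"
  shows "s \<odot>\<^bsub>left_quotient R I\<^esub> (I +>\<^bsub>R\<^esub> r) = I +>\<^bsub>R\<^esub> (s \<otimes>\<^bsub>R\<^esub> r)"
proof -
  interpret R: ring R by (rule R)
  interpret I: abelian_subgroup I R
    by (rule abelian_subgroupI3[OF I R.abelian_group_axioms])
  have "I +>\<^bsub>R\<^esub> (s \<otimes>\<^bsub>R\<^esub> r') = I +>\<^bsub>R\<^esub> (s \<otimes>\<^bsub>R\<^esub> r)" if r': "r' \<in> I +>\<^bsub>R\<^esub> r" for r'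
  proof -
    have c: "r' \<in> carrier R" by (rule I.a_elemrcos_carrier[OF r r'])
    from r' obtain i where i: "i \<in> I" "r' = i \<oplus>\<^bsub>R\<^esub> r"
      by (auto simp: a_r_coset_def')
    have ic: "i \<in> carrier R" using i by simp
    have "s \<otimes>\<^bsub>R\<^esub> r' = s \<otimes>\<^bsub>R\<^esub> i \<oplus>\<^bsub>R\<^esub> s \<otimes>\<^bsub>R\<^esub> r"
      using i ic s r by (simp add: R.r_distr)
    then have "s \<otimes>\<^bsub>R\<^esub> r' \<in> I +>\<^bsub>R\<^esub> (s \<otimes>\<^bsub>R\<^esub> r)"
      using left[OF s i(1)] by (auto simp: a_r_coset_def')
    then show ?thesis
      using I.a_repr_independence'[of "s \<otimes>\<^bsub>R\<^esub> r'" "s \<otimes>\<^bsub>R\<^esub> r"] s r by simp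
  qed
  then have "(\<Union>r'\<in>I +>\<^bsub>R\<^esub> r. I +>\<^bsub>R\<^esub> (s \<otimes>\<^bsub>R\<^esub> r')) = (\<Union>r'\<in>I +>\<^bsub>R\<^esub> r. I +>\<^bsub>R\<^esub> (s \<otimes>\<^bsub>R\<^esub> r))"
    by (rule SUP_cong[OF refl])
  also have "\<dots> = I +>\<^bsub>R\<^esub> (s \<otimes>\<^bsub>R\<^esub> r)"
    using I.a_rcos_self[OF r] by blast
  finally show ?thesis by (simp add: left_quotient_def)
qed

lemma left_module_left_quotient:
  assumes R: "ring R" and I: "additive_subgroup I R"
    and left: "\<And>s r. s \<in> carrier R \<Longrightarrow> r \<in> I \<Longrightarrow> s \<otimes>\<^bsub>R\<^esub> r \<in> I"
  shows "left_module R (left_quotient R I)"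
proof -
  interpret R: ring R by (rule R)
  interpret I: abelian_subgroup I R
    by (rule abelian_subgroupI3[OF I R.abelian_group_axioms])
  let ?M = "left_quotient R I"
  have carr: "\<exists>r\<in>carrier R. C = I +>\<^bsub>R\<^esub> r" if "C \<in> carrier ?M" for C
    using that by (auto simp: left_quotient_def A_RCOSETS_def')
  have in_carr: "I +>\<^bsub>R\<^esub> r \<in> carrier ?M" if "r \<in> carrier R" for r
    using that by (auto simp: left_quotient_def A_RCOSETS_def')
  have add: "(I +>\<^bsub>R\<^esub> r) \<oplus>\<^bsub>?M\<^esub> (I +>\<^bsub>R\<^esub> s) = I +>\<^bsub>R\<^esub> (r \<oplus>\<^bsub>R\<^esub> s)"
    if "r \<in> carrier R" "s \<in> carrier R" for r s
    using I.a_rcos_sum[OF that] by (simp add: left_quotient_def)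
  have zero: "\<zero>\<^bsub>?M\<^esub> = I +>\<^bsub>R\<^esub> \<zero>\<^bsub>R\<^esub>"
    using I.a_subset by (simp add: left_quotient_def)
  have ab: "abelian_group ?M"
  proof (rule abelian_groupI)
    fix C assume "C \<in> carrier ?M"
    then obtain r where r: "r \<in> carrier R" "C = I +>\<^bsub>R\<^esub> r" using carr by blast
    show "\<exists>D\<in>carrier ?M. D \<oplus>\<^bsub>?M\<^esub> C = \<zero>\<^bsub>?M\<^esub>"
      by (rule bexI[of _ "I +>\<^bsub>R\<^esub> (\<ominus>\<^bsub>R\<^esub> r)"]) (simp_all add: r add in_carr zero R.l_neg)
  qed (auto dest!: carr intro!: in_carr simp: add zero R.a_ac)
  note smult = left_quotient_smult[OF R I left]
  show ?thesis
    by (intro left_module.intro R ab left_module_axioms.intro)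
       (auto dest!: carr intro!: in_carr simp: smult add R.l_distr R.r_distr R.m_assoc)
qed


section \<open>The module \<open>N\<^sub>\<beta>\<close>\<close>

text \<open>In a non-commutative ring \<^const>\<open>cgenideal\<close> is the principal left ideal \<open>R a\<close>.\<close>

definition N_ideal :: "nat \<Rightarrow> ratfun \<Rightarrow> (int \<Rightarrow>\<^sub>0 ratfun) set"
  where "N_ideal m \<beta> = PIdl\<^bsub>skew_laurent\<^esub> (xpow (int m) - coef \<beta>)"

definition N_mod :: "nat \<Rightarrow> ratfun \<Rightarrow> (int \<Rightarrow>\<^sub>0 ratfun, (int \<Rightarrow>\<^sub>0 ratfun) set) module"
  where "N_mod m \<beta> = left_quotient skew_laurent (N_ideal m \<beta>)"

definition vvec :: "nat \<Rightarrow> ratfun \<Rightarrow> nat \<Rightarrow> (int \<Rightarrow>\<^sub>0 ratfun) set"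
  where "vvec m \<beta> j = N_ideal m \<beta> +>\<^bsub>skew_laurent\<^esub> xpow (int j)"

text \<open>An \<open>R\<close>-module as a complex vector space, along \<open>\<complex> \<subseteq> \<complex>(h) \<subseteq> R\<close>.\<close>

definition cspace ::
    "(int \<Rightarrow>\<^sub>0 ratfun, 'c) module \<Rightarrow> (complex, 'c) module"
  where "cspace = restrict_scalars (\<lambda>c. coef (ratC c))"

lemma ratC_add: "ratC (a + b) = ratC a + ratC b"
  by (simp add: ratC_def)

lemma ratC_mult: "ratC (a * b) = ratC a * ratC b"
  by (simp add: ratC_def mult.commute)

lemma ratC_0 [simp]: "ratC 0 = 0"
  by (simp add: ratC_def Zero_fract_def)

lemma ratC_1 [simp]: "ratC 1 = 1"
  by (simp add: ratC_def One_fract_def pCons_one)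

lemma left_module_N_mod: "left_module skew_laurent (N_mod m \<beta>)"
  unfolding N_mod_def
proof (rule left_module_left_quotient[OF ring_skew_laurent])
  interpret R: ring skew_laurent by (rule ring_skew_laurent)
  let ?R = skew_laurent and ?g = "xpow (int m) - coef \<beta>"
  have carr [simp]: "r \<in> carrier ?R" for r by (simp add: skew_laurent_def)
  have I: "r \<in> N_ideal m \<beta> \<longleftrightarrow> (\<exists>y. r = y \<otimes>\<^bsub>?R\<^esub> ?g)" for r
    by (simp add: N_ideal_def cgenideal_def)
  show "s \<otimes>\<^bsub>?R\<^esub> r \<in> N_ideal m \<beta>" if "r \<in> N_ideal m \<beta>" for s r
  proof -
    from that obtain y where "r = y \<otimes>\<^bsub>?R\<^esub> ?g" using I by blast
    then have "s \<otimes>\<^bsub>?R\<^esub> r = (s \<otimes>\<^bsub>?R\<^esub> y) \<otimes>\<^bsub>?R\<^esub> ?g" by (simp only: R.m_assoc carr)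
    then show ?thesis using I by blast
  qed
  show "additive_subgroup (N_ideal m \<beta>) ?R"
  proof (rule additive_subgroupI, rule R.add.subgroupI)
    show "N_ideal m \<beta> \<subseteq> carrier ?R" by (simp add: subset_iff)
    show "N_ideal m \<beta> \<noteq> {}" using I by blast
    show "\<ominus>\<^bsub>?R\<^esub> a \<in> N_ideal m \<beta>" if "a \<in> N_ideal m \<beta>" for a
    proof -
      from that obtain y where "a = y \<otimes>\<^bsub>?R\<^esub> ?g" using I by blast
      then have "\<ominus>\<^bsub>?R\<^esub> a = (\<ominus>\<^bsub>?R\<^esub> y) \<otimes>\<^bsub>?R\<^esub> ?g" by (simp only: R.l_minus carr)
      then show ?thesis using I by blast
    qed
    show "a \<oplus>\<^bsub>?R\<^esub> b \<in> N_ideal m \<beta>" if "a \<in> N_ideal m \<beta>" "b \<in> N_ideal m \<beta>" for a b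
    proof -
      from that obtain y z where "a = y \<otimes>\<^bsub>?R\<^esub> ?g" "b = z \<otimes>\<^bsub>?R\<^esub> ?g" using I by blast
      then have "a \<oplus>\<^bsub>?R\<^esub> b = (y \<oplus>\<^bsub>?R\<^esub> z) \<otimes>\<^bsub>?R\<^esub> ?g"
        by (simp only: R.l_distr carr)
      then show ?thesis using I by blast
    qed
  qed
qed

lemma vectorspace_cspace:
  assumes "left_module skew_laurent M"
  shows "vectorspace class_ring (cspace M)"
proof -
  interpret M: left_module skew_laurent M by (rule assms)
  have [simp]: "r \<in> carrier skew_laurent" for r by (simp add: skew_laurent_def)
  have hom: "coef (ratC (a + b)) = coef (ratC a) \<oplus>\<^bsub>skew_laurent\<^esub> coef (ratC b)"
    "coef (ratC (a * b)) = coef (ratC a) \<otimes>\<^bsub>skew_laurent\<^esub> coef (ratC b)"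
    "coef 1 = \<one>\<^bsub>skew_laurent\<^esub>" for a b
    by (simp_all add: coef_def ratC_add ratC_mult skew_laurent_def single_add skew_mult_single
        shift_by_0)
  have "abelian_group (cspace M)"
  proof (rule abelian_groupI)
    fix x assume "x \<in> carrier (cspace M)"
    then show "\<exists>y\<in>carrier (cspace M). y \<oplus>\<^bsub>cspace M\<^esub> x = \<zero>\<^bsub>cspace M\<^esub>"
      by (intro bexI[of _ "\<ominus>\<^bsub>M\<^esub> x"]) (simp_all add: cspace_def restrict_scalars_def M.M.l_neg)
  qed (auto simp: cspace_def restrict_scalars_def M.M.a_ac)
  then have "Module.module class_ring (cspace M)"
    by (intro moduleI class_cring.is_cring)
       (simp_all add: class_ring_simps cspace_def restrict_scalars_def hom
          M.smult_closed M.smult_l_distr M.smult_r_distr M.smult_assoc1 M.smult_one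
          del: skew_laurent_simps)
  moreover have "Ring.field (class_ring :: complex ring)"
    using class_field.field_axioms by (simp add: class_field_def)
  ultimately show ?thesis
    by (intro vectorspace.intro)
qed


section \<open>\<open>R\<close>-modules as \<open>sl\<^sub>2\<close>-modules\<close>

text \<open>The triple \<open>(a, b, c)\<close> stands for \<open>a e + b f + c h\<close>.\<close>

type_synonym sl2 = "complex \<times> complex \<times> complex"

fun sl2_bracket :: "sl2 \<Rightarrow> sl2 \<Rightarrow> sl2"
  where "sl2_bracket (a, b, c) (a', b', c') =
    (2 * (c * a' - a * c'), 2 * (b * c' - c * b'), a * b' - b * a')"

text \<open>The map \<open>e \<mapsto> x\<close>, \<open>f \<mapsto> (\<theta> - (h + 1)\<^sup>2) / 4 x\<^sup>-\<^sup>1\<close>, \<open>h \<mapsto> h\<close> extended linearly.\<close>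

fun sl2_to_R :: "complex \<Rightarrow> sl2 \<Rightarrow> (int \<Rightarrow>\<^sub>0 ratfun)"
  where "sl2_to_R \<theta> (a, b, c) =
    coef (ratC a) \<otimes>\<^bsub>skew_laurent\<^esub> xpow 1
    + coef (ratC b) \<otimes>\<^bsub>skew_laurent\<^esub> (coef ((ratC \<theta> - (ratH + 1)^2) / ratC 4) \<otimes>\<^bsub>skew_laurent\<^esub> xpow (-1))
    + coef (ratC c) \<otimes>\<^bsub>skew_laurent\<^esub> coef ratH"

definition sl2_submodule ::
    "complex \<Rightarrow> (int \<Rightarrow>\<^sub>0 ratfun, 'c) module \<Rightarrow> 'c set \<Rightarrow> bool"
  where "sl2_submodule \<theta> M H \<longleftrightarrow>
    Module.submodule H class_ring (cspace M) \<and> (\<forall>X. \<forall>v\<in>H. sl2_to_R \<theta> X \<odot>\<^bsub>M\<^esub> v \<in> H)"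

definition sl2_simple_submodule ::
    "complex \<Rightarrow> (int \<Rightarrow>\<^sub>0 ratfun, 'c) module \<Rightarrow> 'c set \<Rightarrow> bool"
  where "sl2_simple_submodule \<theta> M H \<longleftrightarrow>
    sl2_submodule \<theta> M H \<and> H \<noteq> {\<zero>\<^bsub>M\<^esub>} \<and>
    (\<forall>K. sl2_submodule \<theta> M K \<and> K \<subseteq> H \<longrightarrow> K = {\<zero>\<^bsub>M\<^esub>} \<or> K = H)"

text \<open>The socle is the sum of all simple submodules, that is, the span of their union.\<close>

definition sl2_socle :: "complex \<Rightarrow> (int \<Rightarrow>\<^sub>0 ratfun, 'c) module \<Rightarrow> 'c set"
  where "sl2_socle \<theta> M =
    LinearCombinations.module.span class_ring (cspace M) (\<Union> {H. sl2_simple_submodule \<theta> M H})"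

text \<open>The map is a homomorphism of Lie algebras, and \<open>(h + 1)\<^sup>2 + 4 f e\<close> acts as \<open>\<theta>\<close>.\<close>

lemma sl2_to_R_single:
  "sl2_to_R \<theta> (a, b, c) =
     Poly_Mapping.single 1 (ratC a)
     + Poly_Mapping.single (-1) (ratC b * (ratC (1/4) * (ratC \<theta> - (ratH + 1)^2)))
     + Poly_Mapping.single 0 (ratC c * ratH)"
proof -
  have "ratC (1/4) * ratC 4 = 1"
    by (simp flip: ratC_mult)
  then have "inverse (ratC 4) = ratC (1/4)"
    by (metis inverse_unique mult.commute)
  then have q: "q / ratC 4 = ratC (1/4) * q" for q
    by (simp only: divide_inverse mult.commute)
  show ?thesis
    by (simp only: sl2_to_R.simps skew_laurent_simps xpow_def coef_def skew_mult_single q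
        shift_by_0 of_int_0 mult_zero_right mult_1_right add_0_left add_0_right shift_1)
qed

lemma shift_diff: "shift a (p - q) = shift a p - shift a q"
  using shift_add[of a "p - q" q] by (simp add: algebra_simps)

lemma sl2_to_R_bracket:
  "sl2_to_R \<theta> (sl2_bracket X Y) =
     sl2_to_R \<theta> X \<otimes>\<^bsub>skew_laurent\<^esub> sl2_to_R \<theta> Y - sl2_to_R \<theta> Y \<otimes>\<^bsub>skew_laurent\<^esub> sl2_to_R \<theta> X"
proof -
  obtain a b c a' b' c' where X: "X = (a, b, c)" and Y: "Y = (a', b', c')"
    by (cases X; cases Y) auto
  define F where "F = ratC (1/4) * (ratC \<theta> - (ratH + 1)^2)"
  have diff: "ratC (p - q) = ratC p - ratC q" for p q
    using ratC_add[of "p - q" q] by (simp add: algebra_simps)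
  have two: "ratC 2 = 2" "ratC (-2) = -2"
    using ratC_add[of 1 1] diff[of 0 2] by simp_all
  have H: "shift 2 ratH = ratH - 2" "shift (-2) ratH = ratH + 2"
    by (simp_all add: shift_ratH two)
  have "ratC (1/4) * 4 = 1"
    using ratC_mult[of "1/4" 4] ratC_add[of 2 2] two by simp
  moreover have "shift 2 ((ratH + 1)^2) = (ratH - 1)^2"
    by (simp add: power2_eq_square shift_mult shift_add H)
  then have "shift 2 F - F = ratC (1/4) * ((ratH + 1)^2 - (ratH - 1)^2)"
    unfolding F_def by (simp add: shift_mult shift_diff right_diff_distrib)
  moreover have "(ratH + 1)^2 - (ratH - 1)^2 = 4 * ratH"
    by (simp add: power2_eq_square algebra_simps)
  ultimately have "shift 2 F - F = ratH"
    by (simp only: mult_1 mult.assoc[symmetric])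
  then have F: "shift 2 F = F + ratH"
    by (simp only: diff_eq_eq add.commute)
  have cases: "P" if "k = 2 \<Longrightarrow> P" "k = 1 \<Longrightarrow> P" "k = 0 \<Longrightarrow> P" "k = - 1 \<Longrightarrow> P" "k = - 2 \<Longrightarrow> P"
    "k \<noteq> 2 \<Longrightarrow> k \<noteq> 1 \<Longrightarrow> k \<noteq> 0 \<Longrightarrow> k \<noteq> - 1 \<Longrightarrow> k \<noteq> - 2 \<Longrightarrow> P" for k :: int and P
    using that by blast
  have prod: "sl2_to_R \<theta> (a, b, c) \<otimes>\<^bsub>skew_laurent\<^esub> sl2_to_R \<theta> (a', b', c') =
      Poly_Mapping.single 2 (ratC a * ratC a')
      + Poly_Mapping.single 1 (ratC a * ratC c' * (ratH - 2) + ratC c * ratC a' * ratH)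
      + Poly_Mapping.single 0 (ratC a * ratC b' * (F + ratH) + ratC b * ratC a' * F
          + ratC c * ratC c' * ratH^2)
      + Poly_Mapping.single (-1) (ratC b * ratC c' * F * (ratH + 2) + ratC c * ratC b' * ratH * F)
      + Poly_Mapping.single (-2) (ratC b * ratC b' * F * shift (-2) F)" for a b c a' b' c'
    unfolding sl2_to_R_single F_def[symmetric] skew_laurent_simps
      skew_mult_add_left skew_mult_add_right skew_mult_single
    apply (rule poly_mapping_eqI)
    subgoal for k
      by (rule cases[of k])
         (simp_all add: lookup_add lookup_single when_def shift_by_0 shift_mult H F
           power2_eq_square algebra_simps)
    done
  show ?thesis
    unfolding X Y sl2_bracket.simps prod
    unfolding sl2_to_R_single F_def[symmetric]
    apply (rule poly_mapping_eqI)
    subgoal for k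
      by (rule cases[of k])
         (simp_all add: lookup_add lookup_minus lookup_single when_def ratC_mult diff two algebra_simps)
    done
qed

lemma sl2_to_R_casimir:
  "(sl2_to_R \<theta> (0, 0, 1) + coef 1) \<otimes>\<^bsub>skew_laurent\<^esub> (sl2_to_R \<theta> (0, 0, 1) + coef 1)
     + coef (ratC 4) \<otimes>\<^bsub>skew_laurent\<^esub> (sl2_to_R \<theta> (0, 1, 0) \<otimes>\<^bsub>skew_laurent\<^esub> sl2_to_R \<theta> (1, 0, 0))
   = coef (ratC \<theta>)"
proof -
  have "ratC 4 * ratC (1/4) = 1"
    by (simp flip: ratC_mult)
  then have q: "ratC 4 * (ratC (1/4) * q) = q" for q
    by (simp only: mult_1 mult.assoc[symmetric])
  have f: "(p + 1) * (p + 1) + (t - (p + 1)^2) = t" for p t :: ratfun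
    by (simp add: power2_eq_square)
  show ?thesis
    by (simp only: sl2_to_R_single skew_laurent_simps coef_def ratC_0 ratC_1 mult_zero_left mult_1_left
        single_zero add_0_left add_0_right single_add[symmetric] skew_mult_single
        of_int_0 mult_zero_right shift_by_0 shift_1 mult_1_right q left_minus of_int_minus f)
qed


section \<open>Parameters\<close>

definition Omega :: "real \<Rightarrow> complex set"
  where "Omega \<omega> = {z. \<omega> \<le> Re z \<and> Re z < \<omega> + 2}"

definition Omega_m :: "real \<Rightarrow> nat \<Rightarrow> complex set"
  where "Omega_m \<omega> m = {z. \<omega> \<le> Re z \<and> Re z < \<omega> + 2 * real m}"

text \<open>A tuple \<open>(c, \<zeta>\<^sub>0, \<dots>, \<zeta>\<^sub>m\<^sub>-\<^sub>1)\<close> is a pair; values of \<open>\<zeta> i\<close> for \<open>i \<ge> m\<close> or outside \<open>\<Omega>\<^sub>\<omega>\<close> are never used.\<close>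

definition Psi :: "real \<Rightarrow> nat \<Rightarrow> (complex \<times> (nat \<Rightarrow> complex \<Rightarrow> int)) set"
  where "Psi \<omega> m = {(c, \<zeta>). c \<noteq> 0 \<and> (\<forall>i<m. finite {z\<in>Omega \<omega>. \<zeta> i z \<noteq> 0})}"

fun g_fun :: "real \<Rightarrow> nat \<Rightarrow> complex \<times> (nat \<Rightarrow> complex \<Rightarrow> int) \<Rightarrow> ratfun"
  where "g_fun \<omega> m (c, \<zeta>) =
    ratC c * (\<Prod>i<m. \<Prod>z\<in>{z\<in>Omega \<omega>. \<zeta> i z \<noteq> 0}. (ratH - ratC z - ratC (2 * of_nat i)) powi \<zeta> i z)"


section \<open>The spanning family\<close>

definition root_count :: "complex \<Rightarrow> complex \<Rightarrow> complex \<Rightarrow> nat \<Rightarrow> nat"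
  where "root_count r1 r2 z n =
    card {s \<in> {1, 2 :: nat}. (if s = 1 then r1 else r2) \<in> (\<lambda>t. z - 2 * of_nat t) ` {1..n}}"

datatype family_index = IdxA nat nat | IdxB complex nat nat nat | IdxC complex nat nat nat

text \<open>\<open>IdxA i j\<close> is the element with parameters \<open>i, j\<close> of the first kind; \<open>IdxB z i j k\<close> and
  \<open>IdxC z i j k\<close> are those with parameters \<open>z, i, j, k\<close> of the second and third kind.\<close>

definition family_indices ::
    "real \<Rightarrow> nat \<Rightarrow> complex \<Rightarrow> complex \<Rightarrow> (complex \<Rightarrow> int) \<Rightarrow> family_index set"
  where "family_indices \<omega> m r1 r2 \<mu> =
    {IdxA i j | i j. j < m}
    \<union> {IdxB z i j k | z i j k. z \<in> Omega_m \<omega> m \<and> \<mu> z < 0 \<and> j < m \<and> 1 \<le> k \<and> int k \<le> - \<mu> z}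
    \<union> {IdxC z i j k | z i j k. z \<in> Omega_m \<omega> m \<and> \<mu> z > 0 \<and> j < m \<and> 1 \<le> k \<and>
         int k \<le> \<mu> z - int (root_count r1 r2 z (m * i + (m - j)))}"

fun family_elem :: "nat \<Rightarrow> ratfun \<Rightarrow> family_index \<Rightarrow> (int \<Rightarrow>\<^sub>0 ratfun) set"
  where
    "family_elem m \<beta> (IdxA i j) = coef (ratH ^ i) \<odot>\<^bsub>N_mod m \<beta>\<^esub> vvec m \<beta> j"
  | "family_elem m \<beta> (IdxB z i j k) =
       coef (1 / (ratH - ratC z - ratC (2 * of_nat m * of_nat i) - ratC (2 * of_nat j)) ^ k)
         \<odot>\<^bsub>N_mod m \<beta>\<^esub> vvec m \<beta> j"
  | "family_elem m \<beta> (IdxC z i j k) =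
       coef (1 / (ratH - ratC z + ratC (2 * of_nat m * of_nat i) + ratC (2 * of_nat (m - j))) ^ k)
         \<odot>\<^bsub>N_mod m \<beta>\<^esub> vvec m \<beta> j"

end

theory Submission
  imports Defs "HOL-Computational_Algebra.Fundamental_Theorem_Algebra"
begin

text \<open>Since \<open>x\<close> moves poles by \<open>2\<close>, the poles that a vector \<open>\<Sum>\<^sub>j a\<^sub>j v\<^sub>j\<close> of \<open>N\<^sub>\<beta>\<close> can have are organised
  in chains \<open>\<lambda> + 2 s\<close> for \<open>\<lambda> \<in> Omega_m \<omega> m\<close> and \<open>s \<in> \<int>\<close>, the pole at \<open>\<lambda> + 2 s\<close> being one of the component
  \<open>s mod m\<close>. Along a chain, \<open>e\<close> raises \<open>s\<close> and \<open>f\<close> lowers it, and the pole order changes only between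
  \<open>s = -1\<close> and \<open>s = 0\<close>, where \<open>\<beta>\<close> contributes, and at the zeros \<open>r\<^sub>1, r\<^sub>2\<close>, where \<open>f\<close> may lower it; all of
  the latter have \<open>s < 0\<close>. A nonzero \<open>sl\<^sub>2\<close>-submodule \<open>K\<close> spans \<open>N\<^sub>\<beta>\<close> over \<open>\<complex>(h)\<close> by simplicity, so it contains
  vectors of pole order at least \<open>0\<close> at almost all points of a chain, and \<open>e\<close> and \<open>f\<close> propagate them to the
  bounds given by the family. As \<open>\<complex>[h]\<close>-submodules of \<open>\<complex>(h)\<close> are determined locally, \<open>K\<close> contains the
  space \<open>L\<close> of all vectors within these bounds. The space \<open>L\<close> is itself a submodule, hence the socle, and
  the same local argument shows that the family spans it.\<close>

section \<open>Linear factors and their behaviour under shifts\<close>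

definition lin :: "complex \<Rightarrow> ratfun"
  where "lin z = ratH - ratC z"

lemma ratC_conv: "ratC c = to_fract [:c:]"
  by (simp add: ratC_def to_fract_def)

lemma lin_conv: "lin z = to_fract [:-z, 1:]"
  by (simp add: lin_def ratC_def ratH_def to_fract_def)

lemma lin_nonzero [simp]: "lin z \<noteq> 0"
  unfolding lin_conv by simp

lemma ratC_eq_0_iff [simp]: "ratC c = 0 \<longleftrightarrow> c = 0"
  by (simp add: ratC_conv)

lemma ratC_uminus: "ratC (- c) = - ratC c"
  by (simp add: ratC_conv flip: to_fract_uminus)

lemma ratC_inverse: "ratC (inverse c) = inverse (ratC c)"
  by (cases "c = 0") (simp_all flip: ratC_mult add: inverse_eq_divide nonzero_eq_divide_eq)

lemma shift_to_fract: "shift t (to_fract p) = to_fract (pcompose p [:-t, 1:])"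
  by (simp add: to_fract_def shift_Fract pcompose_1)

lemma shift_eq_0_iff [simp]: "shift t a = 0 \<longleftrightarrow> a = 0"
  by (metis add.right_inverse shift_0 shift_by_0 shift_shift add.left_inverse)

lemma shift_inverse: "shift t (inverse a) = inverse (shift t a)"
proof (cases "a = 0")
  case False
  then have "shift t a * shift t (inverse a) = 1"
    by (simp flip: shift_mult)
  then show ?thesis by (metis inverse_unique)
qed simp

lemma shift_divide: "shift t (a / b) = shift t a / shift t b"
  by (simp add: divide_inverse shift_mult shift_inverse)

lemma shift_power: "shift t (a ^ n) = shift t a ^ n"
  by (induction n) (simp_all add: shift_mult)

lemma shift_power_int: "shift t (a powi n) = shift t a powi n"
  by (simp add: power_int_def shift_power shift_inverse)

lemma shift_lin: "shift t (lin z) = lin (z + t)"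
  by (simp add: lin_def shift_diff shift_ratH ratC_add)

section \<open>Pole orders of rational functions\<close>

text \<open>This is the local ring of C[h] at \<open>z\<close>. The fraction need not be reduced, so
  closure under sums and products involves no common divisors.\<close>

definition regular_at :: "complex \<Rightarrow> ratfun \<Rightarrow> bool"
  where "regular_at z a \<longleftrightarrow> (\<exists>u w. poly w z \<noteq> 0 \<and> a = to_fract u / to_fract w)"

lemma regular_at_divide: "poly w z \<noteq> 0 \<Longrightarrow> regular_at z (to_fract u / to_fract w)"
  unfolding regular_at_def by blast

lemma regular_at_to_fract [simp]: "regular_at z (to_fract u)"
  using regular_at_divide[of 1 z u] by simp

lemma regular_at_0 [simp]: "regular_at z 0"
  using regular_at_to_fract[of z 0] by simp

lemma regular_at_1 [simp]: "regular_at z 1"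
  using regular_at_to_fract[of z 1] by simp

lemma regular_at_inverse: "poly w z \<noteq> 0 \<Longrightarrow> regular_at z (inverse (to_fract w))"
  using regular_at_divide[of w z 1] by (simp add: divide_inverse)

lemma regular_at_add:
  assumes "regular_at z a" "regular_at z b" shows "regular_at z (a + b)"
proof -
  from assms obtain u w u' w' where *: "poly w z \<noteq> 0" "a = to_fract u / to_fract w"
      "poly w' z \<noteq> 0" "b = to_fract u' / to_fract w'"
    unfolding regular_at_def by blast
  then have "w \<noteq> 0" "w' \<noteq> 0" by auto
  then have eq: "a + b = to_fract (u * w' + u' * w) / to_fract (w * w')"
    using * by (simp add: field_simps)
  show ?thesis unfolding eq using * by (intro regular_at_divide) simp
qed

lemma regular_at_mult:
  assumes "regular_at z a" "regular_at z b" shows "regular_at z (a * b)"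
proof -
  from assms obtain u w u' w' where *: "poly w z \<noteq> 0" "a = to_fract u / to_fract w"
      "poly w' z \<noteq> 0" "b = to_fract u' / to_fract w'"
    unfolding regular_at_def by blast
  have eq: "a * b = to_fract (u * u') / to_fract (w * w')"
    using * by simp
  show ?thesis unfolding eq using * by (intro regular_at_divide) simp
qed

lemma regular_at_lin [simp]: "regular_at z (lin w)"
  unfolding lin_conv by simp

lemma regular_at_power: "regular_at z a \<Longrightarrow> regular_at z (a ^ n)"
  by (induction n) (simp_all add: regular_at_mult)

lemma regular_at_lin_powi: "z \<noteq> w \<Longrightarrow> regular_at z (lin w powi n)"
  unfolding power_int_def lin_conv
  by (auto intro!: regular_at_power regular_at_inverse)

lemma regular_at_shift:
  assumes "regular_at z a" shows "regular_at (z + t) (shift t a)"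
proof -
  from assms obtain u w where *: "poly w z \<noteq> 0" "a = to_fract u / to_fract w"
    unfolding regular_at_def by blast
  then show ?thesis
    by (simp add: shift_divide shift_to_fract regular_at_divide poly_pcompose)
qed

text \<open>The valuation at \<open>z\<close> is at least \<open>- k\<close>, so a negative
  \<open>k\<close> demands a zero. That a nonzero \<open>b\<close> has a pole of order at least
  \<open>k\<close> is expressed below by \<open>pole_le z (- k) (inverse b)\<close>.\<close>

definition pole_le :: "complex \<Rightarrow> int \<Rightarrow> ratfun \<Rightarrow> bool"
  where "pole_le z k a \<longleftrightarrow> regular_at z (lin z powi k * a)"

lemma pole_le_mono:
  assumes "pole_le z k a" "k \<le> l" shows "pole_le z l a"
proof -
  have eq: "lin z powi l * a = lin z ^ nat (l - k) * (lin z powi k * a)"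
    using assms(2) by (simp add: power_int_add[symmetric] flip: mult.assoc power_int_of_nat)
  show ?thesis
    using assms(1) unfolding pole_le_def eq
    by (rule regular_at_mult[OF regular_at_power[OF regular_at_lin]])
qed

lemma pole_le_0_iff: "pole_le z 0 a \<longleftrightarrow> regular_at z a"
  by (simp add: pole_le_def)

lemma pole_le_mult:
  assumes "pole_le z k a" "pole_le z l b" shows "pole_le z (k + l) (a * b)"
  using regular_at_mult[OF assms[unfolded pole_le_def]]
  by (simp add: pole_le_def power_int_add algebra_simps)

lemma pole_le_add: "pole_le z k a \<Longrightarrow> pole_le z k b \<Longrightarrow> pole_le z k (a + b)"
  by (simp add: pole_le_def distrib_left regular_at_add)

lemma pole_le_zero [simp]: "pole_le z k 0"
  by (simp add: pole_le_def)

lemma pole_le_to_fract_mult: "pole_le z k a \<Longrightarrow> pole_le z k (to_fract p * a)"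
  using pole_le_mult[of z 0 "to_fract p" k a] by (simp add: pole_le_0_iff)

lemma pole_le_sum: "(\<And>i. i \<in> S \<Longrightarrow> pole_le z k (f i)) \<Longrightarrow> pole_le z k (sum f S)"
  by (induction S rule: infinite_finite_induct) (auto simp: pole_le_add)

lemma pole_le_prod:
  "(\<And>i. i \<in> S \<Longrightarrow> pole_le z (k i) (f i)) \<Longrightarrow> pole_le z (sum k S) (prod f S)"
  by (induction S rule: infinite_finite_induct) (auto simp: pole_le_mult pole_le_0_iff)

lemma pole_le_shift: "pole_le z k a \<Longrightarrow> pole_le (z + t) k (shift t a)"
  using regular_at_shift[of z "lin z powi k * a" t]
  by (simp add: pole_le_def shift_mult shift_power_int shift_lin)

lemma pole_le_lin_powi: "pole_le z (if z = w then - n else 0) (lin w powi n)"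
  by (auto simp: pole_le_def regular_at_lin_powi simp flip: power_int_add)

lemma pole_le_ratC [simp]: "pole_le z 0 (ratC c)"
  by (simp add: pole_le_0_iff ratC_conv)

text \<open>Otherwise clearing denominators gives \<open>c * w = u * (h - z)\<close> with
  \<open>w\<close> nonzero at \<open>z\<close>, and evaluation at \<open>z\<close> yields a
  contradiction.\<close>

lemma not_pole_le_const:
  assumes "c \<noteq> 0" shows "\<not> pole_le z (k - 1) (ratC c * lin z powi (- k))"
proof
  assume "pole_le z (k - 1) (ratC c * lin z powi (- k))"
  moreover have "lin z powi (k - 1) * (ratC c * lin z powi (- k)) = ratC c * inverse (lin z)"
    by (simp add: power_int_diff power_int_minus field_simps)
  ultimately have "regular_at z (ratC c * inverse (lin z))"
    by (simp add: pole_le_def)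
  then obtain u w where w: "poly w z \<noteq> 0" "ratC c * inverse (lin z) = to_fract u / to_fract w"
    unfolding regular_at_def by blast
  then have "w \<noteq> 0" by auto
  then have "ratC c * to_fract w = to_fract u * lin z"
    using w by (simp add: field_simps)
  then have "to_fract ([:c:] * w) = to_fract (u * [:-z, 1:])"
    unfolding ratC_conv lin_conv to_fract_mult .
  then have "[:c:] * w = u * [:-z, 1:]"
    unfolding to_fract_eq_iff .
  then have "poly ([:c:] * w) z = 0" by simp
  then show False using w assms by simp
qed

section \<open>Submodules of \<open>\<complex>(h)\<close> over \<open>\<complex>[h]\<close>\<close>

definition poly_submodule :: "ratfun set \<Rightarrow> bool"
  where "poly_submodule K \<longleftrightarrow>
    0 \<in> K \<and> (\<forall>a\<in>K. \<forall>b\<in>K. a + b \<in> K) \<and> (\<forall>p. \<forall>a\<in>K. to_fract p * a \<in> K)"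

text \<open>The polynomials \<open>s\<close> with \<open>s * a\<close> in \<open>K\<close> form an
  ideal of C[h]. Its generator has no root, since no point is a common zero of the ideal, so it is a
  nonzero constant.\<close>

lemma poly_submodule_local:
  assumes K: "poly_submodule K" and loc: "\<And>z. \<exists>s. poly s z \<noteq> 0 \<and> to_fract s * a \<in> K"
  shows "a \<in> K"
proof -
  define I where "I = {s. to_fract s * a \<in> K}"
  obtain s where "poly s 0 \<noteq> 0" "s \<in> I" using loc[of 0] unfolding I_def by auto
  then have "\<exists>n. \<exists>s\<in>I. s \<noteq> 0 \<and> degree s = n" by (metis poly_0)
  \<comment> \<open>A nonzero member of least degree generates the ideal, by division with
    remainder.\<close>
  then obtain g where g: "g \<in> I" "g \<noteq> 0"
      and least: "\<And>s. s \<in> I \<Longrightarrow> s \<noteq> 0 \<Longrightarrow> degree g \<le> degree s"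
    using exists_least_iff[of "\<lambda>n. \<exists>s\<in>I. s \<noteq> 0 \<and> degree s = n"]
    by (metis leI)
  have dvd: "g dvd s" if "s \<in> I" for s
  proof -
    have "s mod g = s + (- (s div g)) * g"
      by (simp add: minus_div_mult_eq_mod[symmetric])
    then have eq: "to_fract (s mod g) * a = to_fract s * a + to_fract (- (s div g)) * (to_fract g * a)"
      by (simp only: to_fract_add to_fract_mult algebra_simps)
    have "s mod g \<in> I"
      using that g(1) K unfolding I_def poly_submodule_def mem_Collect_eq eq by blast
    then have "s mod g = 0"
      using least degree_mod_less'[of g s] g(2) by force
    then show ?thesis by auto
  qed
  have "degree g = 0"
  proof (rule ccontr)
    assume "degree g \<noteq> 0"
    then have "\<not> constant (poly g)"
      by (simp add: constant_degree)
    then obtain z where z: "poly g z = 0"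
      using fundamental_theorem_of_algebra by blast
    obtain s where s: "poly s z \<noteq> 0" "s \<in> I"
      using loc[of z] unfolding I_def by auto
    from dvd[OF s(2)] z s(1) show False by (auto elim!: dvdE)
  qed
  then obtain c where c: "g = [:c:]" "c \<noteq> 0"
    using g(2) by (metis degree_0_id of_nat_0 degree_eq_zeroE pCons_0_0)
  have "to_fract [:inverse c:] * (to_fract g * a) \<in> K"
    using g(1) K unfolding I_def poly_submodule_def by blast
  moreover have "to_fract [:inverse c:] * (to_fract g * a) = a"
    using c by (simp flip: mult.assoc to_fract_mult) (simp flip: one_pCons)
  ultimately show ?thesis by simp
qed

text \<open>At each \<open>z\<close> the quotient \<open>a / b\<close> is regular, so
  \<open>w * a = u * b\<close> with \<open>w\<close> nonzero at \<open>z\<close>; this is the local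
  condition of \<open>poly_submodule_local\<close>.\<close>

lemma poly_submodule_pole_le:
  assumes K: "poly_submodule K"
    and loc: "\<And>z. \<exists>k. pole_le z k a \<and> (\<exists>b\<in>K. b \<noteq> 0 \<and> pole_le z (- k) (inverse b))"
  shows "a \<in> K"
proof (rule poly_submodule_local[OF K])
  fix z
  obtain k b where b: "pole_le z k a" "b \<in> K" "b \<noteq> 0" "pole_le z (- k) (inverse b)"
    using loc by blast
  from pole_le_mult[OF b(1,4)] obtain u w where w: "poly w z \<noteq> 0" "a * inverse b = to_fract u / to_fract w"
    by (auto simp: pole_le_0_iff regular_at_def)
  then have "w \<noteq> 0" by auto
  then have "to_fract w * a = to_fract u * b"
    using w b(3) by (simp add: field_simps)
  then show "\<exists>s. poly s z \<noteq> 0 \<and> to_fract s * a \<in> K"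
    using w(1) b(2) K unfolding poly_submodule_def by metis
qed

section \<open>Partial fractions and their independence over the complex numbers\<close>

fun partial_fraction :: "nat + complex \<times> nat \<Rightarrow> ratfun"
  where
    "partial_fraction (Inl i) = ratH ^ i"
  | "partial_fraction (Inr (z, k)) = inverse (lin z ^ k)"

lemma pole_le_partial_fraction_Inr:
  "pole_le z (if z = w then int k else 0) (partial_fraction (Inr (w, k)))"
  using pole_le_lin_powi[of z w "- int k"] by (simp add: power_int_minus split: if_splits)

lemma pole_le_partial_fraction_Inl: "pole_le z 0 (partial_fraction (Inl i))"
  by (simp add: pole_le_0_iff ratH_def flip: to_fract_def) (simp add: regular_at_power)

text \<open>At each pole the term of highest order cannot be cancelled, so the polar terms go first;
  what remains is a polynomial. The assumption \<open>pos\<close> keeps the constant 1 from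
  occurring both as \<open>Inl 0\<close> and as \<open>Inr (z, 0)\<close>.\<close>

lemma partial_fractions_independent:
  assumes fin: "finite T" and pos: "\<And>z. Inr (z, 0) \<notin> T"
    and sum: "(\<Sum>t\<in>T. ratC (c t) * partial_fraction t) = 0" and t: "t \<in> T"
  shows "c t = 0"
proof -
  have Inr: "c (Inr (z, k)) = 0" if "Inr (z, k) \<in> T" for z k
  proof (rule ccontr)
    assume nz: "c (Inr (z, k)) \<noteq> 0"
    define S where "S = {k. Inr (z, k) \<in> T \<and> c (Inr (z, k)) \<noteq> 0}"
    have "S \<subseteq> (\<lambda>t. snd (projr t)) ` T" by (force simp: S_def)
    then have finS: "finite S" using fin finite_subset by blast
    \<comment> \<open>The highest order at \<open>z\<close> with a nonzero coefficient; all other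
      contributions have order at most \<open>k0 - 1\<close> there.\<close>
    define k0 where "k0 = Max S"
    have "k0 \<in> S" unfolding k0_def using nz that finS by (intro Max_in) (auto simp: S_def)
    then have k0: "Inr (z, k0) \<in> T" "c (Inr (z, k0)) \<noteq> 0" by (auto simp: S_def)
    then have "k0 \<noteq> 0" using pos by metis
    have "pole_le z (int k0 - 1) (ratC (c t) * partial_fraction t)" if t: "t \<in> T - {Inr (z, k0)}" for t
    proof (cases "c t = 0")
      case False
      have "pole_le z (int k0 - 1) (partial_fraction t)"
      proof (cases t)
        case (Inl i)
        then show ?thesis using pole_le_mono[OF pole_le_partial_fraction_Inl] \<open>k0 \<noteq> 0\<close> by simp
      next
        case (Inr b)
        then obtain w k where b: "t = Inr (w, k)" by (cases b) auto
        have "int k < int k0" if "w = z"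
        proof -
          have "k \<in> S" using b t False that by (simp add: S_def)
          then have "k \<le> k0" unfolding k0_def using finS by simp
          then show ?thesis using b t that by (cases "k = k0") auto
        qed
        then show ?thesis
          unfolding b by (intro pole_le_mono[OF pole_le_partial_fraction_Inr]) (use \<open>k0 \<noteq> 0\<close> in auto)
      qed
      then show ?thesis using pole_le_mult[OF pole_le_ratC] by fastforce
    qed simp
    then have "pole_le z (int k0 - 1) (\<Sum>t\<in>T - {Inr (z, k0)}. ratC (c t) * partial_fraction t)"
      by (rule pole_le_sum)
    moreover have "(\<Sum>t\<in>T - {Inr (z, k0)}. ratC (c t) * partial_fraction t)
        = ratC (- c (Inr (z, k0))) * lin z powi (- int k0)"
      using sum unfolding sum.remove[OF fin k0(1)]
      by (simp add: power_int_minus ratC_uminus add_eq_0_iff)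
    ultimately show False
      using not_pole_le_const k0(2) by (metis neg_equal_0_iff_equal)
  qed
  show ?thesis
  proof (cases t)
    case (Inl i)
    \<comment> \<open>The polar coefficients vanish by \<open>Inr\<close>, so this polynomial is the
      whole sum.\<close>
    define p where "p = (\<Sum>t\<in>T. case t of Inl i \<Rightarrow> monom (c t) i | Inr _ \<Rightarrow> 0)"
    have mon: "ratC a * ratH ^ i = to_fract (monom a i)" for a i
    proof -
      have "to_fract x ^ i = to_fract (x ^ i)" for x :: "complex poly" by (induction i) simp_all
      then show ?thesis
        by (simp add: ratC_conv ratH_def monom_altdef flip: to_fract_def to_fract_mult)
    qed
    have "to_fract p = (\<Sum>t\<in>T. ratC (c t) * partial_fraction t)"
      unfolding p_def to_fract_sum
      by (rule sum.cong) (auto simp: mon Inr split: sum.splits)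
    then have "p = 0" using sum by simp
    then have "0 = coeff p i" by simp
    also have "\<dots> = (\<Sum>t'\<in>T. if t' = t then c t else 0)"
      unfolding p_def coeff_sum
      by (rule sum.cong) (auto simp: Inl split: sum.splits)
    also have "\<dots> = c t" using fin t by simp
    finally show ?thesis by simp
  qed (use Inr t in auto)
qed

section \<open>The module \<open>N\<^sub>\<beta>\<close> in coordinates\<close>

lemma N_ideal_iff: "r \<in> N_ideal m \<beta> \<longleftrightarrow> (\<exists>y. r = skew_mult y (xpow (int m) - coef \<beta>))"
  by (simp add: N_ideal_def cgenideal_def)

lemma skew_mult_diff_right: "skew_mult p (q - q') = skew_mult p q - skew_mult p q'"
  using skew_mult_add_right[of p "q - q'" q'] by (simp add: algebra_simps)

lemma skew_mult_diff_left: "skew_mult (p - p') q = skew_mult p q - skew_mult p' q"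
  using skew_mult_add_left[of "p - p'" p' q] by (simp add: algebra_simps)

lemma skew_mult_sum_right: "skew_mult p (sum f S) = (\<Sum>i\<in>S. skew_mult p (f i))"
  by (induction S rule: infinite_finite_induct) (simp_all add: skew_mult_add_right)

lemma additive_subgroup_N_ideal: "additive_subgroup (N_ideal m \<beta>) skew_laurent"
proof (rule additive_subgroupI)
  interpret R: ring skew_laurent by (rule ring_skew_laurent)
  show "subgroup (N_ideal m \<beta>) (add_monoid skew_laurent)"
  proof (rule R.add.subgroupI)
    fix a b assume a: "a \<in> N_ideal m \<beta>" and b: "b \<in> N_ideal m \<beta>"
    then obtain y z where yz: "a = skew_mult y (xpow (int m) - coef \<beta>)" "b = skew_mult z (xpow (int m) - coef \<beta>)"
      unfolding N_ideal_iff by blast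
    have "\<ominus>\<^bsub>skew_laurent\<^esub> a = - a"
      by (rule R.minus_equality) simp_all
    then show "\<ominus>\<^bsub>skew_laurent\<^esub> a \<in> N_ideal m \<beta>"
      using skew_mult_diff_left[of 0 y] yz(1) unfolding N_ideal_iff by (metis diff_0 skew_mult_0(1))
    show "a \<oplus>\<^bsub>skew_laurent\<^esub> b \<in> N_ideal m \<beta>"
      using yz skew_mult_add_left[of y z] unfolding N_ideal_iff skew_laurent_simps by metis
  next
    show "N_ideal m \<beta> \<noteq> {}" using N_ideal_iff by blast
  qed simp
qed

lemma N_ideal_left: "r \<in> N_ideal m \<beta> \<Longrightarrow> skew_mult s r \<in> N_ideal m \<beta>"
  unfolding N_ideal_iff using skew_mult_assoc by metis

locale cyclic_module =
  fixes m :: nat and \<beta> :: ratfun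
  assumes m_pos: "m > 0" and \<beta>_nonzero: "\<beta> \<noteq> 0"
begin

abbreviation "N \<equiv> N_mod m \<beta>"

sublocale N: left_module skew_laurent N
  by (rule left_module_N_mod)

sublocale I: abelian_subgroup "N_ideal m \<beta>" skew_laurent
  by (rule abelian_subgroupI3[OF additive_subgroup_N_ideal N.R.abelian_group_axioms])

definition cls :: "(int \<Rightarrow>\<^sub>0 ratfun) \<Rightarrow> (int \<Rightarrow>\<^sub>0 ratfun) set"
  where "cls r = N_ideal m \<beta> +>\<^bsub>skew_laurent\<^esub> r"

lemma carrier_N: "carrier N = range cls"
  by (auto simp: N_mod_def left_quotient_def A_RCOSETS_def' cls_def)

lemma cls_closed [simp]: "cls r \<in> carrier N"
  by (simp add: carrier_N)

lemma cls_add: "cls r \<oplus>\<^bsub>N\<^esub> cls s = cls (r + s)"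
  using I.a_rcos_sum[of r s] by (simp add: N_mod_def left_quotient_def cls_def)

lemma cls_smult: "s \<odot>\<^bsub>N\<^esub> cls r = cls (skew_mult s r)"
  using left_quotient_smult[OF ring_skew_laurent additive_subgroup_N_ideal, of m \<beta> s r]
  by (simp add: N_mod_def cls_def N_ideal_left)

lemma cls_eq_iff: "cls r = cls s \<longleftrightarrow> r - s \<in> N_ideal m \<beta>"
proof -
  have "cls r = cls s \<longleftrightarrow> r \<in> cls s"
    using I.a_repr_independence'[of r s] I.a_rcos_self[of r] unfolding cls_def by auto
  also have "\<dots> \<longleftrightarrow> r - s \<in> N_ideal m \<beta>"
    by (auto simp: cls_def a_r_coset_def' diff_eq_eq) (metis diff_add_cancel)
  finally show ?thesis .
qed

lemma zero_N: "\<zero>\<^bsub>N\<^esub> = cls 0"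
proof -
  have "cls 0 \<oplus>\<^bsub>N\<^esub> cls 0 = cls 0" by (simp add: cls_add)
  then show ?thesis using N.M.add.l_cancel_one[of "cls 0" "cls 0"] by simp
qed

text \<open>The vector with coordinates \<open>a\<close> with respect to \<open>v\<^sub>0, \<dots>, v\<^sub>m\<^sub>-\<^sub>1\<close>; only \<open>a j\<close> for
  \<open>0 \<le> j < m\<close> matters.\<close>

definition el :: "(int \<Rightarrow> ratfun) \<Rightarrow> (int \<Rightarrow>\<^sub>0 ratfun) set"
  where "el a = cls (\<Sum>j\<in>{0..<int m}. Poly_Mapping.single j (a j))"

text \<open>The factor that arises when \<open>x\<close> carries component \<open>j - 1\<close>,
  read modulo \<open>m\<close>, to component \<open>j\<close>: passing from \<open>m - 1\<close> to
  0 replaces \<open>x^m\<close> by \<beta>.\<close>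

definition wrap :: "int \<Rightarrow> ratfun"
  where "wrap j = (if j = 0 then \<beta> else 1)"

lemma wrap_nonzero [simp]: "wrap j \<noteq> 0"
  using \<beta>_nonzero by (simp add: wrap_def)

lemma el_closed [simp]: "el a \<in> carrier N"
  by (simp add: el_def)

lemma el_cong: "(\<And>j. 0 \<le> j \<Longrightarrow> j < int m \<Longrightarrow> a j = b j) \<Longrightarrow> el a = el b"
  unfolding el_def by (metis (no_types, lifting) atLeastLessThan_iff sum.cong)

lemma el_add: "el a \<oplus>\<^bsub>N\<^esub> el b = el (\<lambda>j. a j + b j)"
  by (simp add: el_def cls_add single_add sum.distrib)

lemma zero_N_el: "\<zero>\<^bsub>N\<^esub> = el (\<lambda>j. 0)"
  by (simp add: zero_N el_def)

lemma el_smult: "coef c \<odot>\<^bsub>N\<^esub> el a = el (\<lambda>j. c * a j)"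
  by (simp add: el_def cls_smult coef_def skew_mult_sum_right skew_mult_single shift_by_0)

lemma el_xpow_1: "xpow 1 \<odot>\<^bsub>N\<^esub> el a = el (\<lambda>j. wrap j * sigma (a ((j - 1) mod int m)))"
proof -
  let ?n = "int m" and ?c = "sigma (a (int m - 1))"
  have n: "?n > 0" using m_pos by simp
  have "skew_mult (xpow 1) (\<Sum>j\<in>{0..<?n}. Poly_Mapping.single j (a j))
      = (\<Sum>j\<in>{0..<?n}. Poly_Mapping.single (j + 1) (sigma (a j)))"
    by (simp add: xpow_def skew_mult_sum_right skew_mult_single add.commute)
  also have "\<dots> = (\<Sum>j\<in>{0..<?n-1}. Poly_Mapping.single (j + 1) (sigma (a j)))
      + Poly_Mapping.single ?n ?c"
  proof -
    have "{0..<?n} = insert (?n - 1) {0..<?n-1}" using n by auto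
    then show ?thesis by (simp add: add.commute)
  qed
  also have "(\<Sum>j\<in>{0..<?n-1}. Poly_Mapping.single (j + 1) (sigma (a j)))
      = (\<Sum>j\<in>{1..<?n}. Poly_Mapping.single j (wrap j * sigma (a ((j - 1) mod ?n))))"
    by (rule sum.reindex_bij_witness[of _ "\<lambda>j. j - 1" "\<lambda>j. j + 1"])
       (auto simp: wrap_def)
  finally have 1: "skew_mult (xpow 1) (\<Sum>j\<in>{0..<?n}. Poly_Mapping.single j (a j))
      = (\<Sum>j\<in>{1..<?n}. Poly_Mapping.single j (wrap j * sigma (a ((j - 1) mod ?n))))
        + Poly_Mapping.single ?n ?c" .
  have "{0..<?n} = insert 0 {1..<?n}" using n by auto
  moreover have "(- 1) mod ?n = ?n - 1" using n by (simp add: zmod_minus1)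
  ultimately have 2: "(\<Sum>j\<in>{0..<?n}. Poly_Mapping.single j (wrap j * sigma (a ((j - 1) mod ?n))))
      = (\<Sum>j\<in>{1..<?n}. Poly_Mapping.single j (wrap j * sigma (a ((j - 1) mod ?n))))
        + Poly_Mapping.single 0 (\<beta> * ?c)"
    by (simp add: wrap_def add.commute)
  \<comment> \<open>The overflowing term and its reduction differ by a left multiple of
    \<open>x^m - \<beta>\<close>.\<close>
  have "Poly_Mapping.single ?n ?c - Poly_Mapping.single 0 (\<beta> * ?c)
      = skew_mult (Poly_Mapping.single 0 ?c) (xpow ?n - coef \<beta>)"
    by (simp add: skew_mult_diff_right xpow_def coef_def skew_mult_single shift_by_0 mult.commute)
  then have "Poly_Mapping.single ?n ?c - Poly_Mapping.single 0 (\<beta> * ?c) \<in> N_ideal m \<beta>"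
    unfolding N_ideal_iff by blast
  then show ?thesis
    by (simp add: el_def cls_smult cls_eq_iff 1 2)
qed

lemma xpow_smult_xpow: "v \<in> carrier N \<Longrightarrow> xpow i \<odot>\<^bsub>N\<^esub> (xpow k \<odot>\<^bsub>N\<^esub> v) = xpow (i + k) \<odot>\<^bsub>N\<^esub> v"
  using N.smult_assoc1[of "xpow i" "xpow k" v] by (simp add: xpow_def skew_mult_single)

lemma xpow_0_smult: "v \<in> carrier N \<Longrightarrow> xpow 0 \<odot>\<^bsub>N\<^esub> v = v"
  using N.smult_one[of v] by (simp add: xpow_def del: single_one)

text \<open>The right-hand side is read off by solving \<open>el_xpow_1\<close> for
  \<open>a\<close>; it suffices that \<open>x\<close> sends it to \<open>el a\<close>.\<close>

lemma el_xpow_minus_1: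
  "xpow (-1) \<odot>\<^bsub>N\<^esub> el a = el (\<lambda>j. shift (-2) (a ((j + 1) mod int m) / wrap ((j + 1) mod int m)))"
    (is "_ = el ?b")
proof -
  have "wrap j * sigma (?b ((j - 1) mod int m)) = a j" if "0 \<le> j" "j < int m" for j
    using that by (simp add: shift_shift shift_by_0 mod_simps)
  then have "xpow 1 \<odot>\<^bsub>N\<^esub> el ?b = el a"
    unfolding el_xpow_1 by (intro el_cong) blast
  then show ?thesis
    using xpow_smult_xpow[of "el ?b" "-1" 1] xpow_0_smult by simp
qed

lemma single_smult:
  assumes "v \<in> carrier N"
  shows "Poly_Mapping.single i c \<odot>\<^bsub>N\<^esub> v = coef c \<odot>\<^bsub>N\<^esub> (xpow i \<odot>\<^bsub>N\<^esub> v)"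
  using N.smult_assoc1[of "coef c" "xpow i" v] assms
  by (simp add: coef_def xpow_def skew_mult_single shift_by_0)

lemma xpow_smult_induct:
  assumes v: "v \<in> carrier N" "v \<in> H"
    and step: "\<And>u. u \<in> carrier N \<Longrightarrow> u \<in> H \<Longrightarrow> xpow 1 \<odot>\<^bsub>N\<^esub> u \<in> H \<and> xpow (-1) \<odot>\<^bsub>N\<^esub> u \<in> H"
  shows "xpow i \<odot>\<^bsub>N\<^esub> v \<in> H"
proof (induction i rule: int_induct[of _ 0])
  case base
  then show ?case using v by (simp add: xpow_0_smult)
next
  case (step1 i)
  then show ?case
    using step[of "xpow i \<odot>\<^bsub>N\<^esub> v"] xpow_smult_xpow[of v 1 i] v N.smult_closed
    by (simp add: add.commute)
next
  case (step2 i)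
  then show ?case
    using step[of "xpow i \<odot>\<^bsub>N\<^esub> v"] xpow_smult_xpow[of v "-1" i] v N.smult_closed
    by (simp add: add.commute)
qed

text \<open>\<open>R\<close> is generated by C(h), \<open>x\<close> and the inverse of
  \<open>x\<close>. This serves both for the range of \<open>el\<close> and for the C(h)-span of an
  sl2-submodule.\<close>

lemma smult_induct:
  assumes v: "v \<in> carrier N" "v \<in> H" and zero: "\<zero>\<^bsub>N\<^esub> \<in> H"
    and add: "\<And>u w. u \<in> H \<Longrightarrow> w \<in> H \<Longrightarrow> u \<oplus>\<^bsub>N\<^esub> w \<in> H"
    and coef: "\<And>c u. u \<in> carrier N \<Longrightarrow> u \<in> H \<Longrightarrow> coef c \<odot>\<^bsub>N\<^esub> u \<in> H"
    and step: "\<And>u. u \<in> carrier N \<Longrightarrow> u \<in> H \<Longrightarrow> xpow 1 \<odot>\<^bsub>N\<^esub> u \<in> H \<and> xpow (-1) \<odot>\<^bsub>N\<^esub> u \<in> H"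
  shows "r \<odot>\<^bsub>N\<^esub> v \<in> H"
proof (induction r rule: poly_mapping_single_induct)
  case 1
  have "0 \<odot>\<^bsub>N\<^esub> v = \<zero>\<^bsub>N\<^esub>"
    using v(1) unfolding carrier_N by (auto simp: cls_smult zero_N)
  then show ?case using zero by simp
next
  case (2 i a p)
  have "xpow i \<odot>\<^bsub>N\<^esub> v \<in> carrier N"
    using v(1) N.smult_closed by simp
  then have "Poly_Mapping.single i a \<odot>\<^bsub>N\<^esub> v \<in> H"
    using xpow_smult_induct[of v H] v step coef by (simp add: single_smult)
  moreover have "(Poly_Mapping.single i a + p) \<odot>\<^bsub>N\<^esub> v
      = Poly_Mapping.single i a \<odot>\<^bsub>N\<^esub> v \<oplus>\<^bsub>N\<^esub> p \<odot>\<^bsub>N\<^esub> v"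
    using N.smult_l_distr[of "Poly_Mapping.single i a" p v] v(1) by simp
  ultimately show ?case using 2 add by simp
qed

lemma cls_1: "cls (xpow 0) = el (\<lambda>j. if j = 0 then 1 else 0)"
proof -
  have "(\<Sum>j\<in>{0..<int m}. Poly_Mapping.single j (if j = 0 then 1 else (0::ratfun)))
      = (\<Sum>j\<in>{0..<int m}. if j = 0 then Poly_Mapping.single 0 1 else 0)"
    by (rule sum.cong) auto
  then show ?thesis using m_pos by (simp add: el_def xpow_def)
qed

text \<open>The class of 1 generates \<open>N\<close>, and the range of \<open>el\<close> contains
  it and is stable under the operations in \<open>smult_induct\<close>.\<close>

lemma carrier_N_el: "carrier N = range el"
proof
  have "r \<odot>\<^bsub>N\<^esub> cls (xpow 0) \<in> range el" for r
    by (rule smult_induct)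
       (auto simp: cls_1 zero_N_el el_add el_smult el_xpow_1 el_xpow_minus_1)
  then show "carrier N \<subseteq> range el"
    by (auto simp: carrier_N cls_smult xpow_def skew_mult_one_right simp del: single_one)
qed auto

text \<open>This is the independence of the \<open>v_j\<close> over C(h). If the vector equals
  \<open>y (x^m - \<beta>)\<close>, comparing coefficients gives a recurrence for \<open>y\<close>
  of step \<open>m\<close>, homogeneous outside \<open>0 \<le> k < m\<close>. A nonzero coefficient
  would produce infinitely many others, upward from \<open>k \<ge> 0\<close> and downward from
  \<open>k < 0\<close>, so \<open>y\<close> is zero.\<close>

lemma el_eq_0_iff: "el a = \<zero>\<^bsub>N\<^esub> \<longleftrightarrow> (\<forall>j. 0 \<le> j \<longrightarrow> j < int m \<longrightarrow> a j = 0)"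
proof
  assume "el a = \<zero>\<^bsub>N\<^esub>"
  then have "(\<Sum>j\<in>{0..<int m}. Poly_Mapping.single j (a j)) \<in> N_ideal m \<beta>"
    by (simp add: el_def zero_N cls_eq_iff)
  then obtain y where y: "(\<Sum>j\<in>{0..<int m}. Poly_Mapping.single j (a j))
      = skew_mult y (xpow (int m) - coef \<beta>)"
    unfolding N_ideal_iff by blast
  have lookup_y: "Poly_Mapping.lookup (skew_mult y (xpow (int m) - coef \<beta>)) k
      = Poly_Mapping.lookup y (k - int m) - Poly_Mapping.lookup y k * shift (2 * of_int k) \<beta>" for k
  proof (induction y rule: poly_mapping_single_induct)
    case (2 i c p)
    have "Poly_Mapping.lookup (skew_mult (Poly_Mapping.single i c) (xpow (int m) - coef \<beta>)) k
        = Poly_Mapping.lookup (Poly_Mapping.single i c) (k - int m)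
          - Poly_Mapping.lookup (Poly_Mapping.single i c) k * shift (2 * of_int k) \<beta>"
      by (auto simp: skew_mult_diff_right xpow_def coef_def skew_mult_single lookup_minus lookup_single when_def)
    then show ?case using 2 by (simp add: skew_mult_add_left lookup_add algebra_simps)
  qed simp
  have lookup_a: "Poly_Mapping.lookup (\<Sum>j\<in>{0..<int m}. Poly_Mapping.single j (a j)) k
      = (if 0 \<le> k \<and> k < int m then a k else 0)" for k
    by (simp add: lookup_sum lookup_single when_def)
  have rec: "Poly_Mapping.lookup y (k - int m) - Poly_Mapping.lookup y k * shift (2 * of_int k) \<beta>
      = (if 0 \<le> k \<and> k < int m then a k else 0)" for k
    using lookup_y[of k] lookup_a[of k] y by simp
  have fin: "finite {k. Poly_Mapping.lookup y k \<noteq> 0}"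
    by simp
  have "Poly_Mapping.lookup y k = 0" if "k \<ge> 0" for k
  proof (rule ccontr)
    assume nz: "Poly_Mapping.lookup y k \<noteq> 0"
    have "Poly_Mapping.lookup y (k + int m * int n) \<noteq> 0" for n
    proof (induction n)
      case (Suc n)
      have "0 \<le> k + int m * int n" using that by simp
      then show ?case using Suc rec[of "k + int m * int (Suc n)"] by (auto simp: algebra_simps)
    qed (use nz in simp)
    then have "range (\<lambda>n. k + int m * int n) \<subseteq> {k. Poly_Mapping.lookup y k \<noteq> 0}" by auto
    moreover have "inj (\<lambda>n. k + int m * int n)" using m_pos by (auto simp: inj_def)
    ultimately show False using fin finite_subset range_inj_infinite by blast
  qed
  moreover have "Poly_Mapping.lookup y k = 0" if "k < 0" for k
  proof (rule ccontr)
    assume nz: "Poly_Mapping.lookup y k \<noteq> 0"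
    \<comment> \<open>Downward the recurrence multiplies by a shift of \<beta>, which is
      nonzero.\<close>
    have "Poly_Mapping.lookup y (k - int m * int n) \<noteq> 0" for n
    proof (induction n)
      case (Suc n)
      have "k - int m * int n < 0" using that by (smt (verit) mult_nonneg_nonneg of_nat_0_le_iff)
      then show ?case using Suc rec[of "k - int m * int n"] \<beta>_nonzero by (auto simp: algebra_simps)
    qed (use nz in simp)
    then have "range (\<lambda>n. k - int m * int n) \<subseteq> {k. Poly_Mapping.lookup y k \<noteq> 0}" by auto
    moreover have "inj (\<lambda>n. k - int m * int n)" using m_pos by (auto simp: inj_def)
    ultimately show False using fin finite_subset range_inj_infinite by blast
  qed
  ultimately have "Poly_Mapping.lookup y k = 0" for k
    by (cases "k \<ge> 0") auto
  then show "\<forall>j. 0 \<le> j \<longrightarrow> j < int m \<longrightarrow> a j = 0"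
    using rec by (metis diff_self mult_zero_left)
next
  assume "\<forall>j. 0 \<le> j \<longrightarrow> j < int m \<longrightarrow> a j = 0"
  then show "el a = \<zero>\<^bsub>N\<^esub>"
    unfolding zero_N_el by (intro el_cong) blast
qed

lemma vvec_el: "j < m \<Longrightarrow> vvec m \<beta> j = el (\<lambda>i. if i = int j then 1 else 0)"
proof -
  assume j: "j < m"
  have "(\<Sum>i\<in>{0..<int m}. Poly_Mapping.single i (if i = int j then 1 else (0::ratfun)))
      = (\<Sum>i\<in>{0..<int m}. if i = int j then Poly_Mapping.single (int j) 1 else 0)"
    by (rule sum.cong) auto
  then show ?thesis using j by (simp add: el_def vvec_def cls_def xpow_def)
qed

lemma sl2_act_el:
  "sl2_to_R \<theta> (p, q, r) \<odot>\<^bsub>N\<^esub> el a = el (\<lambda>j.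
     ratC p * (wrap j * sigma (a ((j - 1) mod int m)))
     + ratC q * ((ratC \<theta> - (ratH + 1)^2) / ratC 4
         * shift (-2) (a ((j + 1) mod int m) / wrap ((j + 1) mod int m)))
     + ratC r * (ratH * a j))"
proof -
  have "(s \<otimes>\<^bsub>skew_laurent\<^esub> t) \<odot>\<^bsub>N\<^esub> el a = s \<odot>\<^bsub>N\<^esub> (t \<odot>\<^bsub>N\<^esub> el a)" for s t
    by (rule N.smult_assoc1) simp_all
  moreover have "(s + t) \<odot>\<^bsub>N\<^esub> el a = s \<odot>\<^bsub>N\<^esub> el a \<oplus>\<^bsub>N\<^esub> t \<odot>\<^bsub>N\<^esub> el a" for s t
    using N.smult_l_distr[of s t "el a"] by simp
  ultimately show ?thesis
    by (simp only: sl2_to_R.simps el_xpow_1 el_xpow_minus_1 el_smult el_add)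
qed

subsection \<open>Complex subspaces\<close>

text \<open>A working form of the two library notions of submodule, that of \<open>Module\<close>
  and that of \<open>LinearCombinations\<close>. Negatives come from scaling by -1.\<close>

definition csubspace :: "(int \<Rightarrow>\<^sub>0 ratfun) set set \<Rightarrow> bool"
  where "csubspace H \<longleftrightarrow> H \<subseteq> carrier N \<and> \<zero>\<^bsub>N\<^esub> \<in> H \<and> (\<forall>u\<in>H. \<forall>w\<in>H. u \<oplus>\<^bsub>N\<^esub> w \<in> H)
     \<and> (\<forall>c. \<forall>u\<in>H. coef (ratC c) \<odot>\<^bsub>N\<^esub> u \<in> H)"

sublocale V: vectorspace class_ring "cspace N"
  by (rule vectorspace_cspace[OF left_module_N_mod])

lemma cspace_simps [simp]:
  "carrier (cspace N) = carrier N" "zero (cspace N) = zero N" "add (cspace N) = add N"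
  "c \<odot>\<^bsub>cspace N\<^esub> v = coef (ratC c) \<odot>\<^bsub>N\<^esub> v"
  by (simp_all add: cspace_def restrict_scalars_def)

lemma submodule_cspace_iff: "Module.submodule H class_ring (cspace N) \<longleftrightarrow> csubspace H"
proof
  assume "Module.submodule H class_ring (cspace N)"
  then interpret S: Module.submodule H class_ring "cspace N" .
  show "csubspace H"
    unfolding csubspace_def using S.subset S.one_closed S.m_closed S.smult_closed by auto
next
  assume H: "csubspace H"
  show "Module.submodule H class_ring (cspace N)"
  proof (rule V.submoduleI)
    fix a assume a: "a \<in> H"
    then have "a \<in> carrier (cspace N)" using H unfolding csubspace_def by auto
    then have "\<ominus>\<^bsub>cspace N\<^esub> a = (- 1) \<odot>\<^bsub>cspace N\<^esub> a"
      using V.smult_minus_1[of a] by (simp add: class_ring_simps)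
    then show "\<ominus>\<^bsub>cspace N\<^esub> a \<in> H"
      using a H unfolding csubspace_def by auto
  qed (use H in \<open>auto simp: csubspace_def\<close>)
qed

lemma submodule_iff_csubspace: "LinearCombinations.submodule class_ring H (cspace N) \<longleftrightarrow> csubspace H"
  unfolding LinearCombinations.submodule_def csubspace_def
  using V.module_axioms by auto

lemma csubspace_span: "S \<subseteq> carrier N \<Longrightarrow> csubspace (V.span S)"
  using V.span_is_submodule[of S] by (simp add: submodule_iff_csubspace)

lemma span_superset: "S \<subseteq> carrier N \<Longrightarrow> S \<subseteq> V.span S"
  using V.in_own_span[of S] by simp

lemma span_least: "S \<subseteq> H \<Longrightarrow> csubspace H \<Longrightarrow> V.span S \<subseteq> H"
  using V.span_is_subset[of S H] by (simp add: submodule_iff_csubspace)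

lemma sl2_submodule_iff:
  "sl2_submodule \<theta> N H \<longleftrightarrow> csubspace H \<and> (\<forall>X. \<forall>v\<in>H. sl2_to_R \<theta> X \<odot>\<^bsub>N\<^esub> v \<in> H)"
  by (simp add: sl2_submodule_def submodule_cspace_iff)

text \<open>A least nonzero submodule is the only simple one, so the socle is its span, hence
  itself.\<close>

lemma sl2_socle_unique:
  assumes L: "sl2_submodule \<theta> N L" "L \<noteq> {\<zero>\<^bsub>N\<^esub>}"
    and min: "\<And>K. sl2_submodule \<theta> N K \<Longrightarrow> K \<noteq> {\<zero>\<^bsub>N\<^esub>} \<Longrightarrow> L \<subseteq> K"
  shows "sl2_socle \<theta> N = L"
proof -
  have "sl2_simple_submodule \<theta> N H \<longleftrightarrow> H = L" for H
    using L min unfolding sl2_simple_submodule_def by (metis subset_antisym)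
  then have "{H. sl2_simple_submodule \<theta> N H} = {L}" by auto
  then have "sl2_socle \<theta> N = V.span L" by (simp add: sl2_socle_def)
  moreover have "csubspace L" using L by (simp add: sl2_submodule_iff)
  ultimately show ?thesis
    using span_least[of L L] span_superset[of L] by (auto simp: csubspace_def)
qed

end

declare sl2_to_R.simps [simp del]

section \<open>Vectors supported in a single component\<close>

context cyclic_module
begin

text \<open>For \<open>0 \<le> j < m\<close> this is \<open>a v_j\<close>; for other
  \<open>j\<close> it is zero. Chain positions \<open>s\<close> enter as
  \<open>s mod int m\<close>.\<close>

definition uv :: "int \<Rightarrow> ratfun \<Rightarrow> (int \<Rightarrow>\<^sub>0 ratfun) set"
  where "uv j a = el (\<lambda>i. if i = j then a else 0)"

lemma uv_closed [simp]: "uv j a \<in> carrier N"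
  by (simp add: uv_def)

lemma uv_add: "uv j a \<oplus>\<^bsub>N\<^esub> uv j b = uv j (a + b)"
  unfolding uv_def el_add by (intro el_cong) simp

lemma uv_zero: "uv j 0 = \<zero>\<^bsub>N\<^esub>"
  by (simp add: uv_def zero_N_el)

lemma uv_smult: "coef c \<odot>\<^bsub>N\<^esub> uv j a = uv j (c * a)"
  unfolding uv_def el_smult by (intro el_cong) simp

lemma uv_xpow_1:
  "xpow 1 \<odot>\<^bsub>N\<^esub> uv ((s - 1) mod int m) a = uv (s mod int m) (wrap (s mod int m) * sigma a)"
  unfolding uv_def el_xpow_1
proof (rule el_cong)
  fix j assume "0 \<le> j" "j < int m"
  then have "(j - 1) mod int m = (s - 1) mod int m \<longleftrightarrow> j = s mod int m"
    by (metis mod_diff_left_eq mod_pos_pos_trivial mod_add_left_eq diff_add_cancel)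
  then show "wrap j * sigma (if (j - 1) mod int m = (s - 1) mod int m then a else 0)
      = (if j = s mod int m then wrap (s mod int m) * sigma a else 0)"
    by simp
qed

lemma uv_xpow_minus_1:
  "xpow (-1) \<odot>\<^bsub>N\<^esub> uv ((s + 1) mod int m) a
     = uv (s mod int m) (shift (-2) (a / wrap ((s + 1) mod int m)))"
  unfolding uv_def el_xpow_minus_1
proof (rule el_cong)
  fix j assume "0 \<le> j" "j < int m"
  then have "(j + 1) mod int m = (s + 1) mod int m \<longleftrightarrow> j = s mod int m"
    by (metis mod_diff_left_eq mod_pos_pos_trivial mod_add_left_eq add_diff_cancel_right')
  then show "shift (-2) ((if (j + 1) mod int m = (s + 1) mod int m then a else 0)
         / wrap ((j + 1) mod int m))
      = (if j = s mod int m then shift (-2) (a / wrap ((s + 1) mod int m)) else 0)"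
    by (simp add: mod_simps)
qed

lemma csubspace_el:
  assumes H: "csubspace H" and uv: "\<And>j. 0 \<le> j \<Longrightarrow> j < int m \<Longrightarrow> uv j (a j) \<in> H"
  shows "el a \<in> H"
proof -
  have "el (\<lambda>j. if j < int n then a j else 0) \<in> H" if "n \<le> m" for n
    using that
  proof (induction n)
    case 0
    have "el (\<lambda>j. if j < int 0 then a j else 0) = \<zero>\<^bsub>N\<^esub>"
      unfolding zero_N_el by (intro el_cong) auto
    then show ?case using H by (simp add: csubspace_def)
  next
    case (Suc n)
    have "el (\<lambda>j. if j < int (Suc n) then a j else 0)
        = el (\<lambda>j. if j < int n then a j else 0) \<oplus>\<^bsub>N\<^esub> uv (int n) (a (int n))"
      unfolding uv_def el_add by (intro el_cong) auto
    then show ?case using Suc uv H by (simp add: csubspace_def)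
  qed
  from this[of m] have "el (\<lambda>j. if j < int m then a j else 0) \<in> H" by simp
  moreover have "el (\<lambda>j. if j < int m then a j else 0) = el a"
    by (intro el_cong) auto
  ultimately show ?thesis by simp
qed

lemma csubspace_poly_closed:
  assumes H: "csubspace H" and h: "\<And>v. v \<in> H \<Longrightarrow> coef ratH \<odot>\<^bsub>N\<^esub> v \<in> H" and v: "v \<in> H"
  shows "coef (to_fract p) \<odot>\<^bsub>N\<^esub> v \<in> H"
proof -
  obtain a where a: "v = el a"
    using v H by (auto simp: csubspace_def carrier_N_el)
  show ?thesis
  proof (induction p)
    case 0
    then show ?case using H by (simp add: a el_smult csubspace_def flip: zero_N_el)
  next
    case (pCons c p)
    have "to_fract (pCons c p) = ratC c + ratH * to_fract p"
      by (simp add: ratC_conv ratH_def flip: to_fract_def to_fract_mult to_fract_add)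
    then have "coef (to_fract (pCons c p)) \<odot>\<^bsub>N\<^esub> v
        = coef (ratC c) \<odot>\<^bsub>N\<^esub> v \<oplus>\<^bsub>N\<^esub> coef ratH \<odot>\<^bsub>N\<^esub> (coef (to_fract p) \<odot>\<^bsub>N\<^esub> v)"
      by (simp add: a el_smult el_add algebra_simps)
    then show ?case using pCons h v H by (simp add: csubspace_def)
  qed
qed

text \<open>This makes the local criterion \<open>poly_submodule_pole_le\<close> applicable one
  component at a time.\<close>

lemma poly_submodule_uv:
  assumes "csubspace H" and "\<And>v. v \<in> H \<Longrightarrow> coef ratH \<odot>\<^bsub>N\<^esub> v \<in> H"
  shows "poly_submodule {a. uv j a \<in> H}"
  using csubspace_poly_closed[OF assms] assms(1)
  unfolding poly_submodule_def csubspace_def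
  by (auto simp: uv_zero simp flip: uv_add uv_smult)

end

section \<open>The socle\<close>

locale socle_setup = cyclic_module m \<beta> for m \<beta> +
  fixes \<omega> :: real and r1 r2 \<theta> c :: complex and \<mu> :: "complex \<Rightarrow> int"
  assumes \<theta>: "ratC \<theta> - (ratH + 1)^2 = - (lin r1 * lin r2)"
    and Re_r1: "Re r1 < \<omega>" and Re_r2: "Re r2 < \<omega>"
    and c_nonzero: "c \<noteq> 0"
    and \<beta>_eq: "\<beta> = ratC c * (\<Prod>z\<in>{z\<in>Omega_m \<omega> m. \<mu> z \<noteq> 0}. lin z powi \<mu> z)"
    and fin_\<mu>: "finite {z\<in>Omega_m \<omega> m. \<mu> z \<noteq> 0}"
begin

abbreviation \<Omega> :: "complex set"
  where "\<Omega> \<equiv> Omega_m \<omega> m"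

text \<open>The points \<open>z + 2 s\<close> with \<open>z \<in> \<Omega>\<close> and \<open>s mod m = j\<close> form a system of coordinates on \<open>\<complex>\<close>
  for each \<open>j\<close>; \<open>x\<close> moves the pole of the \<open>j\<close>-th component at \<open>z + 2 s\<close> to \<open>s + 1\<close>.\<close>

abbreviation pt :: "complex \<Rightarrow> int \<Rightarrow> complex"
  where "pt z s \<equiv> z + 2 * of_int s"

lemma pt_ex:
  assumes "0 \<le> j" "j < int m"
  obtains z s where "z \<in> \<Omega>" "s mod int m = j" "w = pt z s"
proof -
  \<comment> \<open>The number of widths \<open>2 * m\<close> by which \<open>w - 2 * j\<close> must
    be moved back to land in the strip \<open>\<Omega>\<close>.\<close>
  define i where "i = \<lfloor>(Re w - 2 * j - \<omega>) / (2 * m)\<rfloor>"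
  define s where "s = int m * i + j"
  define z where "z = w - 2 * of_int s"
  have "of_int i \<le> (Re w - 2 * j - \<omega>) / (2 * m)" "(Re w - 2 * j - \<omega>) / (2 * m) < of_int i + 1"
    unfolding i_def by linarith+
  then have "of_int i * (2 * m) \<le> Re w - 2 * j - \<omega>" "Re w - 2 * j - \<omega> < (of_int i + 1) * (2 * m)"
    using m_pos by (simp_all add: field_simps)
  then have "z \<in> \<Omega>"
    by (simp add: Omega_m_def z_def s_def algebra_simps)
  moreover have "s mod int m = j" using assms by (simp add: s_def)
  ultimately show thesis using that by (simp add: z_def)
qed

text \<open>Here \<open>s - s'\<close> is a multiple of \<open>m\<close>, so \<open>z\<close> and
  \<open>z'\<close> differ by a multiple of \<open>2 * m\<close>, the width of the half-open strip
  \<open>\<Omega>\<close>.\<close>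

lemma pt_inj:
  assumes "z \<in> \<Omega>" "z' \<in> \<Omega>" "s mod int m = s' mod int m" "pt z s = pt z' s'"
  shows "z = z' \<and> s = s'"
proof -
  obtain i where i: "s - s' = int m * i"
    using assms(3) by (metis dvdE mod_eq_dvd_iff)
  have "Re z + 2 * s = Re z' + 2 * s'" using arg_cong[OF assms(4), of Re] by simp
  then have "Re z' - Re z = 2 * of_int (int m * i)" by (simp flip: i)
  moreover have "real_of_int (int m * i) = real m * of_int i" by simp
  moreover have "\<omega> \<le> Re z" "Re z < \<omega> + 2 * real m" "\<omega> \<le> Re z'" "Re z' < \<omega> + 2 * real m"
    using assms(1,2) by (auto simp: Omega_m_def)
  ultimately have "real m * of_int i < real m * 1" "real m * (- 1) < real m * of_int i"
    by linarith+
  then have "of_int i < (1::real)" "- 1 < (of_int i::real)"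
    using m_pos by (simp_all only: mult_less_cancel_left_pos of_nat_0_less_iff)
  then have "i = 0" by linarith
  then show ?thesis using i assms(4) by simp
qed

section \<open>Bounds on the pole orders along a chain\<close>

definition jump :: "complex \<Rightarrow> int \<Rightarrow> int"
  where "jump z s = (if s = 0 then \<mu> z else 0)"

definition ord_q :: "complex \<Rightarrow> int"
  where "ord_q w = (if r1 = w then 1 else 0) + (if r2 = w then 1 else 0)"

text \<open>The largest pole order allowed at \<open>pt z s\<close>. It is governed by the orders of
  vanishing there, \<open>jump z s\<close> for \<open>wrap\<close> and \<open>ord_q (pt z s)\<close>
  for \<open>q\<close>. For \<open>s < 0\<close> the roots met while descending from
  \<open>z - 2\<close> to \<open>pt z s\<close> are deducted.\<close>

definition bnd :: "complex \<Rightarrow> int \<Rightarrow> int"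
  where "bnd z s = (if s \<ge> 0 then max 0 (- \<mu> z)
     else max 0 (\<mu> z - int (root_count r1 r2 z (nat (- s)))))"

lemma bnd_nonneg: "bnd z s \<ge> 0"
  by (simp add: bnd_def)

lemma ord_q_nonneg: "ord_q w \<ge> 0"
  by (simp add: ord_q_def)

lemma root_count_eq:
  "root_count r1 r2 z n = (if r1 \<in> (\<lambda>t. z - 2 * of_nat t) ` {1..n} then 1 else 0)
     + (if r2 \<in> (\<lambda>t. z - 2 * of_nat t) ` {1..n} then 1 else 0)"
proof -
  let ?I = "(\<lambda>t. z - 2 * of_nat t) ` {1..n}"
  have "{s \<in> {1, 2 :: nat}. (if s = 1 then r1 else r2) \<in> ?I}
      = (if r1 \<in> ?I then {1} else {}) \<union> (if r2 \<in> ?I then {2} else {})"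
    by auto
  then show ?thesis unfolding root_count_def by auto
qed

lemma root_count_0: "root_count r1 r2 z 0 = 0"
  by (simp add: root_count_eq)

lemma root_count_Suc:
  "int (root_count r1 r2 z (Suc n)) = int (root_count r1 r2 z n) + ord_q (z - 2 * of_nat (Suc n))"
proof -
  have "(\<lambda>t. z - 2 * of_nat t) ` {1..Suc n}
      = insert (z - 2 * of_nat (Suc n)) ((\<lambda>t. z - 2 * of_nat t) ` {1..n})"
    by (simp add: atLeastAtMostSuc_conv)
  moreover have "z - 2 * of_nat (Suc n) \<notin> (\<lambda>t. z - 2 * of_nat t) ` {1..n}"
    by (auto simp del: of_nat_Suc)
  ultimately show ?thesis
    by (auto simp: root_count_eq ord_q_def simp del: of_nat_Suc)
qed

lemma bnd_neg_Suc: "bnd z (- int n - 1) = max 0 (\<mu> z - int (root_count r1 r2 z (Suc n)))"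
proof -
  have "nat (- (- int n - 1)) = Suc n" by simp
  then show ?thesis unfolding bnd_def by simp
qed

text \<open>Stability under \<open>e\<close>: moving up within \<open>s < 0\<close> can only reduce
  the deducted roots, crossing to \<open>s = 0\<close> costs \<open>\<mu> z\<close>, and afterwards
  the bound is constant.\<close>

lemma bnd_up: "bnd z (s - 1) - jump z s \<le> bnd z s"
proof -
  consider "s > 0" | "s = 0" | "s = - int (nat (- s - 1)) - 1" by linarith
  then show ?thesis
  proof cases
    case 1
    then show ?thesis by (simp add: bnd_def jump_def)
  next
    case 2
    then show ?thesis using bnd_neg_Suc[of z 0] by (simp add: bnd_def jump_def)
  next
    define n where "n = nat (- s - 1)"
    case 3
    then have s: "s = - int n - 1" by (simp only: n_def)
    have "s - 1 = - int (Suc n) - 1" using s by simp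
    then have "bnd z (s - 1) = max 0 (\<mu> z - int (root_count r1 r2 z (Suc (Suc n))))"
      by (simp only: bnd_neg_Suc)
    moreover have "bnd z s = max 0 (\<mu> z - int (root_count r1 r2 z (Suc n)))"
      by (simp only: s bnd_neg_Suc)
    moreover have "jump z s = 0" using s by (simp add: jump_def)
    ultimately show ?thesis
      using root_count_Suc[of z "Suc n"] ord_q_nonneg[of "z - 2 * of_nat (Suc (Suc n))"] by linarith
  qed
qed

text \<open>Stability under \<open>f\<close>: crossing from 0 to -1 gains \<open>\<mu> z\<close>,
  and each step below 0 deducts the roots at the point it reaches. The truncation at 0 only
  helps.\<close>

lemma bnd_down: "bnd z (s + 1) + jump z (s + 1) - ord_q (pt z s) \<le> bnd z s"
proof -
  have q: "ord_q (pt z s) \<ge> 0" by (rule ord_q_nonneg)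
  consider "s \<ge> 0" | "s = - 1" | "s = - int (Suc (nat (- s - 2))) - 1" by linarith
  then show ?thesis
  proof cases
    case 1
    then show ?thesis using q by (simp add: bnd_def jump_def)
  next
    case 2
    then show ?thesis
      using bnd_neg_Suc[of z 0] q root_count_Suc[of z 0] by (simp add: bnd_def jump_def root_count_0)
  next
    define n where "n = nat (- s - 2)"
    case 3
    then have s: "s = - int (Suc n) - 1" by (simp only: n_def)
    have "s + 1 = - int n - 1" using s by simp
    then have "bnd z (s + 1) = max 0 (\<mu> z - int (root_count r1 r2 z (Suc n)))"
      by (simp only: bnd_neg_Suc)
    moreover have "bnd z s = max 0 (\<mu> z - int (root_count r1 r2 z (Suc (Suc n))))"
      by (simp only: s bnd_neg_Suc)
    moreover have "jump z (s + 1) = 0" using s by (simp add: jump_def)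
    moreover have "pt z s = z - 2 * of_nat (Suc (Suc n))" using s by simp
    ultimately show ?thesis
      using root_count_Suc[of z "Suc n"] q by (simp only:)
  qed
qed

lemma pole_le_\<beta>:
  "pole_le w (if w \<in> \<Omega> then - \<mu> w else 0) \<beta>"
  "pole_le w (if w \<in> \<Omega> then \<mu> w else 0) (inverse \<beta>)"
proof -
  let ?S = "{z\<in>\<Omega>. \<mu> z \<noteq> 0}"
  \<comment> \<open>A general exponent covers \<beta> with \<open>\<mu>\<close> and its inverse with
    \<open>- \<mu>\<close>.\<close>
  have *: "pole_le w (if w \<in> \<Omega> then - \<nu> w else 0) (ratC d * (\<Prod>z\<in>?S. lin z powi \<nu> z))"
    if "\<And>z. \<mu> z = 0 \<Longrightarrow> \<nu> z = 0" for \<nu> d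
  proof -
    have "(\<Sum>z\<in>?S. if w = z then - \<nu> z else 0) = (if w \<in> \<Omega> then - \<nu> w else 0)"
      using fin_\<mu> that by auto
    then show ?thesis
      using pole_le_mult[OF pole_le_ratC pole_le_prod[of ?S w "\<lambda>z. if w = z then - \<nu> z else 0"
            "\<lambda>z. lin z powi \<nu> z"]] pole_le_lin_powi
      by simp
  qed
  show "pole_le w (if w \<in> \<Omega> then - \<mu> w else 0) \<beta>"
    using *[of \<mu> c] by (simp add: \<beta>_eq)
  have "inverse \<beta> = ratC (inverse c) * (\<Prod>z\<in>?S. lin z powi (- \<mu> z))"
    by (simp add: \<beta>_eq ratC_inverse power_int_minus flip: prod_inversef)
  then show "pole_le w (if w \<in> \<Omega> then \<mu> w else 0) (inverse \<beta>)"
    using *[of "\<lambda>z. - \<mu> z" "inverse c"] by (cases "w \<in> \<Omega>") simp_all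
qed

text \<open>The factor is \<beta> for every multiple \<open>s\<close> of \<open>m\<close>, but by
  \<open>pt_inj\<close> the point lies in \<open>\<Omega>\<close> only for \<open>s = 0\<close>;
  elsewhere \<beta> has neither zero nor pole at \<open>pt z s\<close>.\<close>

lemma pole_le_wrap:
  assumes z: "z \<in> \<Omega>"
  shows "pole_le (pt z s) (- jump z s) (wrap (s mod int m))"
    and "pole_le (pt z s) (jump z s) (inverse (wrap (s mod int m)))"
proof -
  have "pole_le (pt z s) (- jump z s) (wrap (s mod int m)) \<and>
    pole_le (pt z s) (jump z s) (inverse (wrap (s mod int m)))"
  proof (cases "s mod int m = 0")
    case True
    have "pt z s \<in> \<Omega> \<longleftrightarrow> s = 0"
      using pt_inj[OF z, of "pt z s" s 0] z True by auto
    then show ?thesis using pole_le_\<beta>[of "pt z s"] True by (auto simp: wrap_def jump_def)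
  next
    case False
    then have "s \<noteq> 0" by auto
    then show ?thesis using False by (simp add: wrap_def jump_def pole_le_0_iff)
  qed
  then show "pole_le (pt z s) (- jump z s) (wrap (s mod int m))"
    "pole_le (pt z s) (jump z s) (inverse (wrap (s mod int m)))" by auto
qed

definition q :: ratfun
  where "q = lin r1 * lin r2"

lemma q_nonzero [simp]: "q \<noteq> 0"
  by (simp add: q_def)

lemma pole_le_q:
  "pole_le w (- ord_q w) q" "pole_le w (ord_q w) (inverse q)"
  using pole_le_mult[OF pole_le_lin_powi[of w r1 1] pole_le_lin_powi[of w r2 1]]
    pole_le_mult[OF pole_le_lin_powi[of w r1 "- 1"] pole_le_lin_powi[of w r2 "- 1"]]
  by (auto simp: q_def ord_q_def power_int_minus mult.commute split: if_splits)

lemma sl2_f_coeff: "(ratC \<theta> - (ratH + 1)^2) / ratC 4 = ratC (- 1 / 4) * q"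
proof -
  have "ratC (- 1 / 4) = ratC (- inverse 4)" by simp
  then have quarter: "ratC (- 1 / 4) = - inverse (ratC 4)" by (simp only: ratC_uminus ratC_inverse)
  show ?thesis unfolding \<theta> q_def quarter by (simp add: divide_inverse)
qed

subsection \<open>The submodule \<open>L\<close>\<close>

text \<open>By \<open>pt_ex\<close> the pairs \<open>z\<close>, \<open>s\<close> reach every point
  of the plane in every component, so all poles are constrained.\<close>

definition pole_bounded :: "(int \<Rightarrow> ratfun) \<Rightarrow> bool"
  where "pole_bounded a \<longleftrightarrow> (\<forall>z\<in>\<Omega>. \<forall>s. pole_le (pt z s) (bnd z s) (a (s mod int m)))"

definition L :: "(int \<Rightarrow>\<^sub>0 ratfun) set set"
  where "L = el ` Collect pole_bounded"

lemma pole_boundedD: "pole_bounded a \<Longrightarrow> z \<in> \<Omega> \<Longrightarrow> pole_le (pt z s) (bnd z s) (a (s mod int m))"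
  by (simp add: pole_bounded_def)

lemma L_I: "(\<And>z s. z \<in> \<Omega> \<Longrightarrow> pole_le (pt z s) (bnd z s) (a (s mod int m))) \<Longrightarrow> el a \<in> L"
  by (simp add: L_def pole_bounded_def)

lemma L_E:
  assumes "v \<in> L" obtains a where "v = el a" "pole_bounded a"
  using assms unfolding L_def by blast

lemma csubspace_L: "csubspace L"
  unfolding csubspace_def
proof (intro conjI ballI allI)
  show "L \<subseteq> carrier N" by (auto simp: L_def)
  show "\<zero>\<^bsub>N\<^esub> \<in> L" unfolding zero_N_el by (rule L_I) simp
  fix u assume u: "u \<in> L"
  then obtain a where a: "u = el a" "pole_bounded a"
    by (rule L_E)
  show "u \<oplus>\<^bsub>N\<^esub> w \<in> L" if w: "w \<in> L" for w
  proof -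
    from w obtain b where "w = el b" "pole_bounded b"
      by (rule L_E)
    then show ?thesis using a by (auto simp: el_add intro!: L_I pole_le_add dest: pole_boundedD)
  qed
  show "coef (ratC d) \<odot>\<^bsub>N\<^esub> u \<in> L" for d
    using a by (auto simp: el_smult ratC_conv intro!: L_I pole_le_to_fract_mult dest: pole_boundedD)
qed

lemma L_nonzero: "L \<noteq> {\<zero>\<^bsub>N\<^esub>}"
proof -
  have "el (\<lambda>j. 1) \<in> L"
    by (rule L_I, rule pole_le_mono[OF _ bnd_nonneg]) (simp add: pole_le_0_iff)
  moreover have "el (\<lambda>j. 1) \<noteq> \<zero>\<^bsub>N\<^esub>"
    using m_pos by (auto simp: el_eq_0_iff)
  ultimately show ?thesis by blast
qed

lemma sl2_submodule_L: "sl2_submodule \<theta> N L"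
  unfolding sl2_submodule_iff
proof (intro conjI allI ballI csubspace_L)
  fix X :: sl2 and v assume "v \<in> L"
  then obtain a where a: "v = el a" "pole_bounded a"
    by (rule L_E)
  obtain x y h where X: "X = (x, y, h)" by (cases X)
  show "sl2_to_R \<theta> X \<odot>\<^bsub>N\<^esub> v \<in> L"
    unfolding X a(1) sl2_act_el sl2_f_coeff
  proof (rule L_I, intro pole_le_add)
    fix z s assume z: "z \<in> \<Omega>"
    have 1: "pole_le (pt z s) (bnd z (s - 1)) (sigma (a ((s - 1) mod int m)))"
      using pole_le_shift[OF pole_boundedD[OF a(2) z, of "s - 1"], of 2] by (simp add: algebra_simps)
    have "pole_le (pt z s) (bnd z s) (wrap (s mod int m) * sigma (a ((s - 1) mod int m)))"
      by (rule pole_le_mono[OF pole_le_mult[OF pole_le_wrap(1)[OF z] 1]]) (use bnd_up[of z s] in simp)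
    then show "pole_le (pt z s) (bnd z s)
        (ratC x * (wrap (s mod int m) * sigma (a ((s mod int m - 1) mod int m))))"
      by (simp add: mod_simps ratC_conv pole_le_to_fract_mult)
    \<comment> \<open>For \<open>f\<close>, division by \<open>wrap\<close> happens at position
      \<open>s + 1\<close>, before the shift; the factor \<open>q\<close> then acts at position
      \<open>s\<close>.\<close>
    have "pole_le (pt z (s + 1)) (bnd z (s + 1) + jump z (s + 1))
        (a ((s + 1) mod int m) / wrap ((s + 1) mod int m))"
      unfolding divide_inverse by (intro pole_le_mult pole_boundedD[OF a(2)] z pole_le_wrap)
    then have "pole_le (pt z s) (bnd z (s + 1) + jump z (s + 1))
        (shift (-2) (a ((s + 1) mod int m) / wrap ((s + 1) mod int m)))"
      using pole_le_shift[of "pt z (s + 1)" _ _ "-2"] by (fastforce simp: algebra_simps)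
    from pole_le_mult[OF pole_le_q(1) this]
    have "pole_le (pt z s) (bnd z s) (q * shift (-2) (a ((s + 1) mod int m) / wrap ((s + 1) mod int m)))"
      by (rule pole_le_mono) (use bnd_down[of z s] in simp)
    then have "pole_le (pt z s) (bnd z s) (to_fract [:y:] * (to_fract [:- 1 / 4:] *
        (q * shift (-2) (a ((s + 1) mod int m) / wrap ((s + 1) mod int m)))))"
      by (intro pole_le_to_fract_mult)
    then show "pole_le (pt z s) (bnd z s) (ratC y * (ratC (- 1 / 4) * q *
        shift (-2) (a ((s mod int m + 1) mod int m) / wrap ((s mod int m + 1) mod int m))))"
      by (simp only: mod_simps ratC_conv mult.assoc)
    have "pole_le (pt z s) (bnd z s) (to_fract [:h:] * (to_fract [:0, 1:] * a (s mod int m)))"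
      by (intro pole_le_to_fract_mult pole_boundedD[OF a(2)] z)
    then show "pole_le (pt z s) (bnd z s) (ratC h * (ratH * a (s mod int m)))"
      by (simp add: ratC_conv ratH_def flip: to_fract_def)
  qed
qed

text \<open>The local criterion in each component: at each point \<open>H\<close> attains the bound
  that vectors of \<open>L\<close> respect. Only stability under \<open>h\<close> is required, so it
  applies to submodules and to the span of the family alike.\<close>

lemma L_subset:
  assumes H: "csubspace H" "\<And>v. v \<in> H \<Longrightarrow> coef ratH \<odot>\<^bsub>N\<^esub> v \<in> H"
    and reach: "\<And>z s. z \<in> \<Omega> \<Longrightarrow> \<exists>b. b \<noteq> 0 \<and> uv (s mod int m) b \<in> H \<and> pole_le (pt z s) (- bnd z s) (inverse b)"
  shows "L \<subseteq> H"
proof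
  fix v assume "v \<in> L"
  then obtain a where a: "v = el a" "pole_bounded a"
    by (rule L_E)
  show "v \<in> H"
    unfolding a(1)
  proof (rule csubspace_el[OF H(1)])
    fix j assume j: "0 \<le> j" "j < int m"
    have "a j \<in> {a. uv j a \<in> H}"
    proof (rule poly_submodule_pole_le[OF poly_submodule_uv[OF H]])
      fix w
      obtain z s where z: "z \<in> \<Omega>" "s mod int m = j" "w = pt z s"
        using pt_ex[OF j] by blast
      then show "\<exists>k. pole_le w k (a j) \<and> (\<exists>b\<in>{a. uv j a \<in> H}. b \<noteq> 0 \<and> pole_le w (- k) (inverse b))"
        using pole_boundedD[OF a(2) z(1), of s] reach[OF z(1), of s] by blast
    qed
    then show "uv j (a j) \<in> H" by simp
  qed
qed

subsection \<open>Minimality of \<open>L\<close>\<close>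

context
  fixes K
  assumes K: "sl2_submodule \<theta> N K" and K_nonzero: "K \<noteq> {\<zero>\<^bsub>N\<^esub>}"
    and simple: "simple_left_module skew_laurent N"
begin

lemma csubspace_K: "csubspace K"
  using K by (simp add: sl2_submodule_iff)

lemma K_carrier: "v \<in> K \<Longrightarrow> v \<in> carrier N"
  using csubspace_K by (auto simp: csubspace_def)

lemma K_scale: "v \<in> K \<Longrightarrow> coef (ratC d) \<odot>\<^bsub>N\<^esub> v \<in> K"
  using csubspace_K by (auto simp: csubspace_def)

lemma K_act: "v \<in> K \<Longrightarrow> sl2_to_R \<theta> X \<odot>\<^bsub>N\<^esub> v \<in> K"
  using K unfolding sl2_submodule_iff by blast

lemma K_h: "v \<in> K \<Longrightarrow> coef ratH \<odot>\<^bsub>N\<^esub> v \<in> K"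
  using K_act[of v "(0, 0, 1)"] K_carrier[of v] by (auto simp: carrier_N_el sl2_act_el el_smult)

lemma K_x: "v \<in> K \<Longrightarrow> xpow 1 \<odot>\<^bsub>N\<^esub> v \<in> K"
  using K_act[of v "(1, 0, 0)"] K_carrier[of v] by (auto simp: carrier_N_el sl2_act_el el_xpow_1)

text \<open>Up to the scalar -1/4, \<open>f\<close> acts as \<open>q\<close> times the inverse of
  \<open>x\<close>.\<close>

lemma K_x_inverse:
  assumes "v \<in> K" shows "coef q \<odot>\<^bsub>N\<^esub> (xpow (-1) \<odot>\<^bsub>N\<^esub> v) \<in> K"
proof -
  obtain a where a: "v = el a" using K_carrier[OF assms] by (auto simp: carrier_N_el)
  have one: "ratC (- 4) * ratC (- 1 / 4) = 1"
    by (simp flip: ratC_mult)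
  have cancel: "ratC (- 4) * (ratC (- 1 / 4) * t) = t" for t
    by (simp only: mult.assoc[symmetric] one mult_1_left)
  have "coef q \<odot>\<^bsub>N\<^esub> (xpow (-1) \<odot>\<^bsub>N\<^esub> v)
      = coef (ratC (- 4)) \<odot>\<^bsub>N\<^esub> (sl2_to_R \<theta> (0, 1, 0) \<odot>\<^bsub>N\<^esub> v)"
    by (simp only: a sl2_act_el el_xpow_minus_1 el_smult sl2_f_coeff mult.assoc cancel ratC_0 ratC_1
        mult_zero_left add_0_left add_0_right mult_1_left)
  then show ?thesis using K_scale[OF K_act[OF assms]] by simp
qed

lemma K_poly: "v \<in> K \<Longrightarrow> coef (to_fract p) \<odot>\<^bsub>N\<^esub> v \<in> K"
  by (rule csubspace_poly_closed[OF csubspace_K K_h])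

text \<open>By simplicity of \<open>N\<close>, the \<open>\<complex>(h)\<close>-span of \<open>K\<close>, which is an \<open>R\<close>-submodule, is all of \<open>N\<close>.\<close>

lemma K_denominator:
  assumes "v \<in> carrier N" shows "\<exists>p. p \<noteq> 0 \<and> coef (to_fract p) \<odot>\<^bsub>N\<^esub> v \<in> K"
proof -
  \<comment> \<open>The C(h)-span of \<open>K\<close>, described by common denominators.\<close>
  define H where "H = {v \<in> carrier N. \<exists>p. p \<noteq> 0 \<and> coef (to_fract p) \<odot>\<^bsub>N\<^esub> v \<in> K}"
  have mult: "coef s \<odot>\<^bsub>N\<^esub> (coef t \<odot>\<^bsub>N\<^esub> v) = coef (s * t) \<odot>\<^bsub>N\<^esub> v" if "v \<in> carrier N" for s t v
    using that by (auto simp: carrier_N_el el_smult mult.assoc)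
  have one: "coef 1 \<odot>\<^bsub>N\<^esub> v = v" if "v \<in> carrier N" for v
    using that by (auto simp: carrier_N_el el_smult)
  have K_H: "K \<subseteq> H"
  proof
    fix v assume "v \<in> K"
    then show "v \<in> H" unfolding H_def using K_carrier one
      by (auto intro!: exI[of _ 1])
  qed
  have zero: "\<zero>\<^bsub>N\<^esub> \<in> H"
    using K_H csubspace_K by (auto simp: csubspace_def)
  have add: "u \<oplus>\<^bsub>N\<^esub> w \<in> H" if u: "u \<in> H" and w: "w \<in> H" for u w
  proof -
    from u obtain p where p: "u \<in> carrier N" "p \<noteq> 0" "coef (to_fract p) \<odot>\<^bsub>N\<^esub> u \<in> K"
      by (auto simp: H_def)
    from w obtain p' where p': "w \<in> carrier N" "p' \<noteq> 0" "coef (to_fract p') \<odot>\<^bsub>N\<^esub> w \<in> K"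
      by (auto simp: H_def)
    have "coef (to_fract (p * p')) \<odot>\<^bsub>N\<^esub> (u \<oplus>\<^bsub>N\<^esub> w)
        = coef (to_fract p') \<odot>\<^bsub>N\<^esub> (coef (to_fract p) \<odot>\<^bsub>N\<^esub> u)
          \<oplus>\<^bsub>N\<^esub> coef (to_fract p) \<odot>\<^bsub>N\<^esub> (coef (to_fract p') \<odot>\<^bsub>N\<^esub> w)"
      using p(1) p'(1) by (auto simp: carrier_N_el el_smult el_add algebra_simps)
    also have "\<dots> \<in> K"
      using K_poly p p' csubspace_K by (simp add: csubspace_def)
    finally have "coef (to_fract (p * p')) \<odot>\<^bsub>N\<^esub> (u \<oplus>\<^bsub>N\<^esub> w) \<in> K" .
    moreover have "p * p' \<noteq> 0" using p p' by simp
    ultimately show ?thesis unfolding H_def using p(1) p'(1) by blast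
  qed
  have coef: "coef d \<odot>\<^bsub>N\<^esub> u \<in> H" if u: "u \<in> H" for d u
  proof -
    from u obtain p where p: "u \<in> carrier N" "p \<noteq> 0" "coef (to_fract p) \<odot>\<^bsub>N\<^esub> u \<in> K"
      by (auto simp: H_def)
    obtain x y where d: "d = to_fract x / to_fract y" "y \<noteq> 0"
      by (metis Fract_conv_to_fract Fract_cases)
    have eq: "coef (to_fract (y * p)) \<odot>\<^bsub>N\<^esub> (coef d \<odot>\<^bsub>N\<^esub> u)
        = coef (to_fract x) \<odot>\<^bsub>N\<^esub> (coef (to_fract p) \<odot>\<^bsub>N\<^esub> u)"
      using p(1) d by (simp add: mult mult.commute)
    have "coef (to_fract (y * p)) \<odot>\<^bsub>N\<^esub> (coef d \<odot>\<^bsub>N\<^esub> u) \<in> K"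
      unfolding eq by (rule K_poly[OF p(3)])
    moreover have "y * p \<noteq> 0" using p d by simp
    ultimately show ?thesis
      unfolding H_def using p(1) N.smult_closed[of "coef d" u, simplified] by blast
  qed
  have step: "xpow 1 \<odot>\<^bsub>N\<^esub> u \<in> H \<and> xpow (-1) \<odot>\<^bsub>N\<^esub> u \<in> H" if u: "u \<in> H" for u
  proof -
    from u obtain p where p: "u \<in> carrier N" "p \<noteq> 0" "coef (to_fract p) \<odot>\<^bsub>N\<^esub> u \<in> K"
      by (auto simp: H_def)
    obtain a where a: "u = el a" using p(1) by (auto simp: carrier_N_el)
    have "coef (to_fract (pcompose p [:-2, 1:])) \<odot>\<^bsub>N\<^esub> (xpow 1 \<odot>\<^bsub>N\<^esub> u)
        = xpow 1 \<odot>\<^bsub>N\<^esub> (coef (to_fract p) \<odot>\<^bsub>N\<^esub> u)"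
      by (simp add: a el_xpow_1 el_smult shift_mult mult.left_commute flip: shift_to_fract)
    moreover have "\<dots> \<in> K" using K_x[OF p(3)] .
    moreover have "pcompose p [:-2, 1:] \<noteq> 0" using p(2) by (simp add: pcompose_linear_eq_0_iff)
    ultimately have 1: "xpow 1 \<odot>\<^bsub>N\<^esub> u \<in> H"
      unfolding H_def using p(1) N.smult_closed[of "xpow 1" u] by auto
    \<comment> \<open>\<open>K\<close> is known to be stable only under \<open>q\<close> times the
      inverse of \<open>x\<close>, so the new denominator absorbs \<open>q\<close>.\<close>
    define p' where "p' = [:-r1, 1:] * [:-r2, 1:] * pcompose p [:-(-2), 1:]"
    have "to_fract p' = q * shift (-2) (to_fract p)"
      unfolding p'_def q_def lin_conv shift_to_fract to_fract_mult ..
    then have "coef (to_fract p') \<odot>\<^bsub>N\<^esub> (xpow (-1) \<odot>\<^bsub>N\<^esub> u)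
        = coef q \<odot>\<^bsub>N\<^esub> (xpow (-1) \<odot>\<^bsub>N\<^esub> (coef (to_fract p) \<odot>\<^bsub>N\<^esub> u))"
      by (simp add: a el_xpow_minus_1 el_smult shift_mult shift_divide mult.assoc)
    moreover have "\<dots> \<in> K" using K_x_inverse[OF p(3)] .
    moreover have "p' \<noteq> 0"
      using p(2) pcompose_linear_eq_0_iff[of p "-2"]
      by (simp only: p'_def mult_eq_0_iff pCons_eq_0_iff one_neq_zero simp_thms)
    ultimately have "xpow (-1) \<odot>\<^bsub>N\<^esub> u \<in> H"
      unfolding H_def using p(1) N.smult_closed[of "xpow (-1)" u] by auto
    then show ?thesis using 1 by blast
  qed
  have "Module.submodule H skew_laurent N"
  proof (rule Module.submodule.intro)
    have "r \<odot>\<^bsub>N\<^esub> u \<in> H" if u: "u \<in> H" for r u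
    proof (rule smult_induct[OF _ u zero add])
      show "u \<in> carrier N" using u by (simp add: H_def)
    qed (assumption | rule coef step, assumption)+
    then show "submodule_axioms H skew_laurent N"
      by (intro submodule_axioms.intro) auto
    show "subgroup H (add_monoid N)"
    proof (rule N.M.add.subgroupI)
      fix u assume u: "u \<in> H"
      then have "u \<in> carrier N" by (simp add: H_def)
      then have "\<ominus>\<^bsub>N\<^esub> u = coef (- 1) \<odot>\<^bsub>N\<^esub> u"
        by (intro N.M.minus_equality) (auto simp: carrier_N_el el_smult el_add zero_N_el)
      then show "\<ominus>\<^bsub>N\<^esub> u \<in> H" using coef[OF u] by simp
    qed (use zero add in \<open>auto simp: H_def\<close>)
  qed
  then have "H = {\<zero>\<^bsub>N\<^esub>} \<or> H = carrier N"
    using simple by (auto simp: simple_left_module_def)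
  moreover have "K \<noteq> {}" using csubspace_K by (auto simp: csubspace_def)
  then have "H \<noteq> {\<zero>\<^bsub>N\<^esub>}" using K_H K_nonzero by blast
  ultimately show ?thesis using assms by (auto simp: H_def)
qed

text \<open>\<open>K\<close> contains a one-component vector whose pole order at position
  \<open>s\<close> of the chain of \<open>z\<close> is at least \<open>k\<close>.\<close>

definition reach :: "complex \<Rightarrow> int \<Rightarrow> int \<Rightarrow> bool"
  where "reach z s k \<longleftrightarrow> (\<exists>b. b \<noteq> 0 \<and> uv (s mod int m) b \<in> K \<and> pole_le (pt z s) (- k) (inverse b))"

lemma reach_mono: "reach z s k \<Longrightarrow> l \<le> k \<Longrightarrow> reach z s l"
  unfolding reach_def using pole_le_mono by (metis neg_le_iff_le)

lemma reach_up:
  assumes z: "z \<in> \<Omega>" and "reach z (s - 1) k" shows "reach z s (k - jump z s)"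
proof -
  obtain b where b: "b \<noteq> 0" "uv ((s - 1) mod int m) b \<in> K" "pole_le (pt z (s - 1)) (- k) (inverse b)"
    using assms(2) unfolding reach_def by blast
  let ?b = "wrap (s mod int m) * sigma b"
  have "pole_le (pt z s) (- k) (inverse (sigma b))"
    using pole_le_shift[OF b(3), of 2] by (simp add: shift_inverse algebra_simps)
  from pole_le_mult[OF pole_le_wrap(2)[OF z] this]
  have "pole_le (pt z s) (- (k - jump z s)) (inverse ?b)"
    by (simp add: mult.commute)
  moreover have "uv (s mod int m) ?b \<in> K"
    using K_x[OF b(2)] by (simp add: uv_xpow_1)
  moreover have "?b \<noteq> 0" using b(1) by simp
  ultimately show ?thesis unfolding reach_def by blast
qed

text \<open>Applying \<open>q\<close> times the inverse of \<open>x\<close> strengthens the pole by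
  the zero of \<open>wrap\<close> at \<open>s + 1\<close> and weakens it by the zeros of
  \<open>q\<close> at \<open>s\<close>.\<close>

lemma reach_down:
  assumes z: "z \<in> \<Omega>" and "reach z (s + 1) k" shows "reach z s (k + jump z (s + 1) - ord_q (pt z s))"
proof -
  obtain b where b: "b \<noteq> 0" "uv ((s + 1) mod int m) b \<in> K" "pole_le (pt z (s + 1)) (- k) (inverse b)"
    using assms(2) unfolding reach_def by blast
  let ?w = "wrap ((s + 1) mod int m)"
  let ?b = "q * shift (-2) (b / ?w)"
  have "pole_le (pt z (s + 1)) (- jump z (s + 1) + - k) (?w * inverse b)"
    by (intro pole_le_mult pole_le_wrap z b)
  then have "pole_le (pt z s) (- jump z (s + 1) + - k) (shift (-2) (?w * inverse b))"
    using pole_le_shift[of "pt z (s + 1)" _ _ "-2"] by (fastforce simp: algebra_simps)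
  from pole_le_mult[OF pole_le_q(2) this]
  have "pole_le (pt z s) (- (k + jump z (s + 1) - ord_q (pt z s))) (inverse q * shift (-2) (?w * inverse b))"
    by (simp add: algebra_simps)
  moreover have "inverse q * shift (-2) (?w * inverse b) = inverse ?b"
    by (simp add: shift_inverse shift_divide shift_mult field_simps)
  moreover have "uv (s mod int m) ?b \<in> K"
    using K_x_inverse[OF b(2)] by (simp add: uv_xpow_minus_1 uv_smult)
  moreover have "?b \<noteq> 0" using b(1) by simp
  ultimately show ?thesis unfolding reach_def by metis
qed

text \<open>Some nonzero polynomial multiple of each \<open>v_j\<close> lies in \<open>K\<close>,
  and only finitely many chain points are roots of these polynomials.\<close>

lemma reach_far: "\<exists>S\<ge>0. \<forall>s. \<bar>s\<bar> \<ge> S \<longrightarrow> reach z s 0"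
proof -
  have "\<forall>j. \<exists>p. p \<noteq> 0 \<and> uv j (to_fract p) \<in> K"
    using K_denominator[OF uv_closed[of _ 1]] by (simp add: uv_smult)
  then obtain p where p: "\<And>j. p j \<noteq> 0" "\<And>j. uv j (to_fract (p j)) \<in> K" by metis
  define B where "B = (\<Union>j\<in>{0..<int m}. {s. poly (p j) (pt z s) = 0})"
  have "finite {s. poly (p j) (pt z s) = 0}" for j
  proof (rule finite_imageD[of "pt z"])
    show "finite (pt z ` {s. poly (p j) (pt z s) = 0})"
      by (rule finite_subset[OF _ poly_roots_finite[OF p(1)[of j]]]) auto
  qed (auto simp: inj_on_def)
  then have "finite B" by (simp add: B_def)
  then have "finite (abs ` B)" by simp
  then obtain S where S: "\<And>s. s \<in> B \<Longrightarrow> \<bar>s\<bar> < S"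
    by (metis finite_imageI image_eqI finite_less_ub bdd_above_def bdd_above_finite le_less_trans less_add_one)
  have "reach z s 0" if "\<bar>s\<bar> \<ge> max S 0" for s
  proof -
    let ?p = "p (s mod int m)"
    have "s \<notin> B" using S[of s] that by auto
    then have "poly ?p (pt z s) \<noteq> 0" using m_pos by (auto simp: B_def)
    then have "pole_le (pt z s) 0 (inverse (to_fract ?p))"
      by (simp add: pole_le_0_iff regular_at_inverse)
    then show ?thesis unfolding reach_def using p by (metis minus_zero to_fract_eq_0_iff)
  qed
  then show ?thesis by (intro exI[of _ "max S 0"]) auto
qed

lemma ord_q_right:
  assumes "z \<in> \<Omega>" "s \<ge> 0" shows "ord_q (pt z s) = 0"
proof -
  have "Re (pt z s) \<ge> \<omega>" using assms by (simp add: Omega_m_def)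
  then show ?thesis using Re_r1 Re_r2 by (auto simp: ord_q_def)
qed

text \<open>Negative positions are reached from the far left by \<open>e\<close>, the others from
  the far right by \<open>f\<close>. Neither path crosses between -1 and 0, and \<open>q\<close> has
  no zeros on the right, so the order 0 persists.\<close>

lemma reach_0:
  assumes z: "z \<in> \<Omega>" shows "reach z s 0"
proof -
  obtain S where S: "S \<ge> 0" "\<And>s. \<bar>s\<bar> \<ge> S \<Longrightarrow> reach z s 0" using reach_far by blast
  show ?thesis
  proof (cases "s < 0")
    case True
    have "reach z (- S - 1 + int n) 0" if "- S - 1 + int n < 0" for n
      using that
    proof (induction n)
      case (Suc n)
      then show ?case using reach_up[OF z, of "- S - 1 + int (Suc n)" 0]
        by (simp add: jump_def algebra_simps)
    qed (use S in simp)
    from this[of "nat (s + S + 1)"] show ?thesis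
      using True S by (cases "\<bar>s\<bar> \<ge> S") auto
  next
    case False
    have "reach z (S - int n) 0" if "S - int n \<ge> 0" for n
      using that
    proof (induction n)
      case (Suc n)
      have "S - int n = (S - int (Suc n)) + 1" by simp
      then show ?case using reach_down[OF z, of "S - int (Suc n)" 0] Suc ord_q_right[OF z Suc.prems]
        by (simp add: jump_def)
    qed (use S in simp)
    from this[of "nat (S - s)"] show ?thesis
      using False S by (cases "\<bar>s\<bar> \<ge> S") auto
  qed
qed

text \<open>Start from order 0 just across the jump: going up from -1 gives
  \<open>- \<mu> z\<close>, going down from 0 gives \<open>\<mu> z\<close> less the roots passed.
  The maximum with 0 is supplied by \<open>reach_0\<close>.\<close>

lemma reach_bnd:
  assumes z: "z \<in> \<Omega>" shows "reach z s (bnd z s)"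
proof (cases "s \<ge> 0")
  case True
  have "reach z (int n) (- \<mu> z)" for n
  proof (induction n)
    case 0
    show ?case using reach_up[OF z reach_0[OF z], of 0] by (simp add: jump_def)
  next
    case (Suc n)
    then show ?case using reach_up[OF z, of "int (Suc n)"] by (simp add: jump_def)
  qed
  from this[of "nat s"] show ?thesis
    using True reach_0[OF z, of s] by (auto simp: bnd_def max_def)
next
  case False
  have "reach z (- int n - 1) (\<mu> z - int (root_count r1 r2 z (Suc n)))" for n
  proof (induction n)
    case 0
    show ?case
      using reach_down[OF z reach_0[OF z], of "- 1"] root_count_Suc[of z 0]
      by (simp add: jump_def root_count_0)
  next
    case (Suc n)
    have "- int (Suc n) - 1 + 1 = - int n - 1" by simp
    then have "reach z (- int (Suc n) - 1 + 1) (\<mu> z - int (root_count r1 r2 z (Suc n)))"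
      using Suc by (simp only:)
    note down = reach_down[OF z this]
    have pt: "pt z (- int (Suc n) - 1) = z - 2 * of_nat (Suc (Suc n))" by simp
    have jump: "jump z (- int (Suc n) - 1 + 1) = 0" by (simp add: jump_def)
    show ?case
      using root_count_Suc[of z "Suc n"] by (intro reach_mono[OF down]) (simp only: pt jump)
  qed
  moreover have "s = - int (nat (- s - 1)) - 1" using False by simp
  ultimately show ?thesis
    using bnd_neg_Suc[of z "nat (- s - 1)"] reach_0[OF z, of s] by (metis max_def)
qed

lemma L_minimal: "L \<subseteq> K"
  using L_subset[OF csubspace_K K_h] reach_bnd unfolding reach_def by blast

end

lemma socle_eq_L: "simple_left_module skew_laurent N \<Longrightarrow> sl2_socle \<theta> N = L"
  using sl2_socle_unique[OF sl2_submodule_L L_nonzero] L_minimal by blast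

end

section \<open>The spanning family\<close>

fun comp_of :: "family_index \<Rightarrow> nat"
  where "comp_of (IdxA i j) = j" | "comp_of (IdxB z i j k) = j" | "comp_of (IdxC z i j k) = j"

text \<open>The poles are written as \<open>pt z s\<close>, with \<open>s = m * i + j\<close> in
  kind (b) and \<open>s = - (m * i + (m - j))\<close> in kind (c); both are congruent to
  \<open>j\<close> modulo \<open>m\<close>.\<close>

fun pf_of :: "nat \<Rightarrow> family_index \<Rightarrow> nat + complex \<times> nat"
  where
    "pf_of m (IdxA i j) = Inl i"
  | "pf_of m (IdxB z i j k) = Inr (z + 2 * of_int (int (m * i + j)), k)"
  | "pf_of m (IdxC z i j k) = Inr (z + 2 * of_int (- int (m * i + (m - j))), k)"

context socle_setup
begin

abbreviation idx :: "family_index set"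
  where "idx \<equiv> family_indices \<omega> m r1 r2 \<mu>"

lemma comp_less: "t \<in> idx \<Longrightarrow> comp_of t < m"
  by (auto simp: family_indices_def)

lemma family_elem_uv:
  assumes "t \<in> idx"
  shows "family_elem m \<beta> t = uv (int (comp_of t)) (partial_fraction (pf_of m t))"
proof -
  have v: "coef a \<odot>\<^bsub>N\<^esub> vvec m \<beta> j = uv (int j) a" if "j < m" for a j
    using that by (simp add: vvec_el uv_smult flip: uv_def)
  show ?thesis
  proof (cases t)
    case (IdxA i j)
    then show ?thesis using comp_less[OF assms] by (simp add: v)
  next
    case (IdxB z i j k)
    have "lin (z + 2 * of_int (int (m * i + j)))
        = ratH - ratC z - ratC (2 * of_nat m * of_nat i) - ratC (2 * of_nat j)"
      by (simp add: lin_def ratC_add algebra_simps)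
    then show ?thesis
      using IdxB comp_less[OF assms] by (simp only: family_elem.simps pf_of.simps partial_fraction.simps comp_of.simps v)
        (simp add: divide_inverse power_inverse)
  next
    case (IdxC z i j k)
    have "lin (z + 2 * of_int (- int (m * i + (m - j))))
        = ratH - ratC z - ratC (- (2 * of_nat m * of_nat i)) - ratC (- (2 * of_nat (m - j)))"
      by (simp add: lin_def ratC_add[symmetric] algebra_simps)
    then have "lin (z + 2 * of_int (- int (m * i + (m - j))))
        = ratH - ratC z + ratC (2 * of_nat m * of_nat i) + ratC (2 * of_nat (m - j))"
      by (simp only: ratC_uminus diff_minus_eq_add)
    then show ?thesis
      using IdxC comp_less[OF assms] by (simp only: family_elem.simps pf_of.simps partial_fraction.simps comp_of.simps v)
        (simp add: divide_inverse power_inverse)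
  qed
qed

text \<open>The sign of \<open>s\<close> tells kinds (b) and (c) apart and its quotient by
  \<open>m\<close> recovers \<open>i\<close>; the last clause is what gives injectivity.\<close>

lemma idx_InrD:
  assumes t: "t \<in> idx" and pf: "pf_of m t = Inr (w, k)"
  obtains z s where "z \<in> \<Omega>" "w = pt z s" "s mod int m = int (comp_of t)" "1 \<le> k" "int k \<le> bnd z s"
    "t = (if s \<ge> 0 then IdxB z (nat (s div int m)) (comp_of t) k
          else IdxC z (nat ((- s - 1) div int m)) (comp_of t) k)"
proof (cases t)
  case (IdxA i j)
  then show ?thesis using pf by simp
next
  case (IdxB z i j k')
  let ?s = "int (m * i + j)"
  have "z \<in> \<Omega>" "\<mu> z < 0" "j < m" "1 \<le> k" "int k \<le> - \<mu> z" "k' = k" "w = pt z ?s"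
    using t pf IdxB by (auto simp: family_indices_def)
  then show ?thesis
    by (intro that[of z ?s]) (simp_all add: IdxB bnd_def)
next
  case (IdxC z i j k')
  define s where "s = - int (m * i + (m - j))"
  have *: "z \<in> \<Omega>" "\<mu> z > 0" "j < m" "1 \<le> k" "int k \<le> \<mu> z - int (root_count r1 r2 z (m * i + (m - j)))"
    "k' = k" "w = pt z s"
    using t pf IdxC by (auto simp: family_indices_def s_def)
  have s1: "s = int j + int m * (- int i - 1)"
    using *(3) by (simp add: s_def of_nat_diff algebra_simps)
  \<comment> \<open>In kind (c) \<open>- s\<close> runs from \<open>m * i + 1\<close> to
    \<open>m * i + m\<close>, so 1 is subtracted before dividing by \<open>m\<close>.\<close>
  have s2: "- s - 1 = (int m - int j - 1) + int m * int i"
    by (simp add: s1 algebra_simps)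
  have "s mod int m = int j" unfolding s1 using *(3) by simp
  moreover have "(- s - 1) div int m = int i" unfolding s2 using *(3) by simp
  moreover have "0 < m * i + (m - j)" using *(3) by simp
  then have "s < 0" by (simp only: s_def neg_less_0_iff_less of_nat_0_less_iff)
  moreover have "nat (- s) = m * i + (m - j)" by (simp only: s_def minus_minus nat_int)
  ultimately show ?thesis
    using * by (intro that[of z s]) (simp_all add: IdxC bnd_def)
qed

lemma idx_Inr_ex:
  assumes z: "z \<in> \<Omega>" and k: "1 \<le> k" "int k \<le> bnd z s"
  obtains t where "t \<in> idx" "int (comp_of t) = s mod int m" "pf_of m t = Inr (pt z s, k)"
proof (cases "s \<ge> 0")
  case True
  define i j where "i = nat (s div int m)" and "j = nat (s mod int m)"
  have ij: "int i = s div int m" "int j = s mod int m"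
    using True m_pos by (simp_all add: i_def j_def pos_imp_zdiv_nonneg_iff)
  have s: "int (m * i + j) = s" by (simp add: ij)
  have "int j < int m" unfolding ij using m_pos by simp
  then have "j < m" by simp
  moreover have "\<mu> z < 0" "int k \<le> - \<mu> z" using k True by (auto simp: bnd_def max_def split: if_splits)
  ultimately have "IdxB z i j k \<in> idx"
    using z k by (auto simp: family_indices_def)
  then show ?thesis by (rule that) (simp_all only: comp_of.simps pf_of.simps s ij)
next
  case False
  define i l where "i = nat ((- s - 1) div int m)" and "l = nat ((- s - 1) mod int m)"
  have il: "int i = (- s - 1) div int m" "int l = (- s - 1) mod int m"
    using False m_pos by (simp_all add: i_def l_def pos_imp_zdiv_nonneg_iff)
  have "int l < int m" unfolding il using m_pos by simp
  then have l: "l < m" by simp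
  \<comment> \<open>The remainder of \<open>- s - 1\<close> counts components backwards from
    \<open>m - 1\<close>.\<close>
  define j where "j = m - 1 - l"
  have j: "j < m" "m - j = l + 1" using l by (auto simp: j_def)
  have "int (m * i + l) = - s - 1" by (simp add: il)
  then have s: "int (m * i + (m - j)) = - s" unfolding j(2) by simp
  have "s = int j + int m * (- int i - 1)"
    using s j(1) by (simp add: of_nat_diff algebra_simps)
  then have smod: "s mod int m = int j" using j(1) by simp
  have "nat (- s) = m * i + (m - j)" using s by linarith
  then have "bnd z s = max 0 (\<mu> z - int (root_count r1 r2 z (m * i + (m - j))))"
    using False by (simp add: bnd_def)
  then have "IdxC z i j k \<in> idx"
    using z k j(1) by (auto simp: family_indices_def max_def split: if_splits)
  then show ?thesis by (rule that) (simp_all only: comp_of.simps pf_of.simps s smod minus_minus)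
qed

lemma idx_InlD: "t \<in> idx \<Longrightarrow> pf_of m t = Inl i \<Longrightarrow> t = IdxA i (comp_of t)"
  by (cases t) auto

lemma idx_inj:
  assumes t: "t \<in> idx" "t' \<in> idx" and eq: "comp_of t = comp_of t'" "pf_of m t = pf_of m t'"
  shows "t = t'"
proof (cases "pf_of m t")
  case (Inl i)
  then show ?thesis using idx_InlD t eq by metis
next
  case (Inr b)
  then obtain w k where w: "pf_of m t = Inr (w, k)" by (cases b) auto
  from idx_InrD[OF t(1) w] obtain z s where z: "z \<in> \<Omega>" "w = pt z s" "s mod int m = int (comp_of t)"
    "t = (if s \<ge> 0 then IdxB z (nat (s div int m)) (comp_of t) k
          else IdxC z (nat ((- s - 1) div int m)) (comp_of t) k)" by metis
  from idx_InrD[OF t(2), of w k] w eq(2) obtain z' s' where z': "z' \<in> \<Omega>" "w = pt z' s'"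
    "s' mod int m = int (comp_of t')"
    "t' = (if s' \<ge> 0 then IdxB z' (nat (s' div int m)) (comp_of t') k
          else IdxC z' (nat ((- s' - 1) div int m)) (comp_of t') k)" by metis
  have "z = z' \<and> s = s'" using z z' eq(1) by (intro pt_inj) simp_all
  then show ?thesis using z(4) z'(4) eq(1) by metis
qed

section \<open>The family spans \<open>L\<close>\<close>

lemma family_in_L:
  assumes t: "t \<in> idx" shows "family_elem m \<beta> t \<in> L"
  unfolding family_elem_uv[OF t] uv_def
proof (rule L_I)
  fix z s assume z: "z \<in> \<Omega>"
  show "pole_le (pt z s) (bnd z s)
      (if s mod int m = int (comp_of t) then partial_fraction (pf_of m t) else 0)"
  proof (cases "s mod int m = int (comp_of t)")
    case True
    have "pole_le (pt z s) (bnd z s) (partial_fraction (pf_of m t))"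
    proof (cases "pf_of m t")
      case (Inl i)
      then show ?thesis
        using pole_le_mono[OF pole_le_partial_fraction_Inl bnd_nonneg] by simp
    next
      case (Inr b)
      then obtain w k where w: "pf_of m t = Inr (w, k)" by (cases b) auto
      from idx_InrD[OF t w] obtain z' s' where z': "z' \<in> \<Omega>" "w = pt z' s'"
        "s' mod int m = int (comp_of t)" "int k \<le> bnd z' s'" by metis
      \<comment> \<open>In a fixed component a point has only one pair of chain coordinates, so the
        bound is the one for the index.\<close>
      have "int k \<le> bnd z s" if "pt z s = w"
        using pt_inj[OF z z'(1), of s s'] that z' True by metis
      then show ?thesis
        unfolding w by (intro pole_le_mono[OF pole_le_partial_fraction_Inr]) (auto simp: bnd_nonneg)
    qed
    then show ?thesis using True by simp
  qed simp
qed

lemma family_carrier: "family_elem m \<beta> ` idx \<subseteq> carrier N"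
  using family_in_L csubspace_L by (auto simp: csubspace_def)

abbreviation Sp :: "(int \<Rightarrow>\<^sub>0 ratfun) set set"
  where "Sp \<equiv> V.span (family_elem m \<beta> ` idx)"

lemma uv_power_in_span:
  assumes "0 \<le> j" "j < int m" shows "uv j (ratH ^ i) \<in> Sp"
proof -
  have "IdxA i (nat j) \<in> idx" using assms by (auto simp: family_indices_def)
  then have "family_elem m \<beta> (IdxA i (nat j)) \<in> Sp"
    using span_superset[OF family_carrier] by blast
  then show ?thesis
    using family_elem_uv[OF \<open>IdxA i (nat j) \<in> idx\<close>] assms by (simp del: family_elem.simps)
qed

text \<open>The case \<open>k = 0\<close> is \<open>v_j\<close> itself, a member of kind (a); it
  occurs when a simple pole is cancelled or the bound is 0.\<close>

lemma uv_inverse_in_span: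
  assumes z: "z \<in> \<Omega>" and k: "int k \<le> bnd z s"
  shows "uv (s mod int m) (inverse (lin (pt z s) ^ k)) \<in> Sp"
proof (cases "k = 0")
  case True
  then show ?thesis using uv_power_in_span[of "s mod int m" 0] m_pos by simp
next
  case False
  then obtain t where t: "t \<in> idx" "int (comp_of t) = s mod int m" "pf_of m t = Inr (pt z s, k)"
    using idx_Inr_ex[OF z _ k] by auto
  then have "family_elem m \<beta> t \<in> Sp"
    using span_superset[OF family_carrier] by blast
  then show ?thesis using family_elem_uv[OF t(1)] t by simp
qed

text \<open>The vectors that \<open>h\<close> sends into the span form a subspace, so members of the
  family suffice. On polar members, \<open>h = w + (h - w)\<close> keeps the order or lowers it by
  one.\<close>

lemma span_h_closed:
  assumes "v \<in> Sp" shows "coef ratH \<odot>\<^bsub>N\<^esub> v \<in> Sp"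
proof -
  have Sp: "csubspace Sp" by (rule csubspace_span[OF family_carrier])
  let ?H = "{v \<in> carrier N. coef ratH \<odot>\<^bsub>N\<^esub> v \<in> Sp}"
  have "csubspace ?H"
    unfolding csubspace_def
  proof (intro conjI ballI allI)
    show "\<zero>\<^bsub>N\<^esub> \<in> ?H"
      using Sp by (simp add: zero_N_el el_smult csubspace_def)
    fix u assume u: "u \<in> ?H"
    show "u \<oplus>\<^bsub>N\<^esub> w \<in> ?H" if w: "w \<in> ?H" for w
      using u w Sp N.smult_r_distr[of "coef ratH" u w] by (auto simp: csubspace_def)
    show "coef (ratC d) \<odot>\<^bsub>N\<^esub> u \<in> ?H" for d
    proof -
      obtain a where a: "u = el a" using u by (auto simp: carrier_N_el)
      have "coef ratH \<odot>\<^bsub>N\<^esub> (coef (ratC d) \<odot>\<^bsub>N\<^esub> u) = coef (ratC d) \<odot>\<^bsub>N\<^esub> (coef ratH \<odot>\<^bsub>N\<^esub> u)"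
        by (simp add: a el_smult mult.left_commute)
      then show ?thesis using u Sp N.smult_closed[of "coef (ratC d)" u] by (simp add: csubspace_def)
    qed
  qed auto
  moreover have "family_elem m \<beta> ` idx \<subseteq> ?H"
  proof (rule image_subsetI)
    fix t assume t: "t \<in> idx"
    have j: "0 \<le> int (comp_of t)" "int (comp_of t) < int m" using comp_less[OF t] by simp_all
    have "coef ratH \<odot>\<^bsub>N\<^esub> family_elem m \<beta> t \<in> Sp"
    proof (cases "pf_of m t")
      case (Inl i)
      then show ?thesis
        using uv_power_in_span[OF j, of "Suc i"] by (simp add: family_elem_uv[OF t] uv_smult)
    next
      case (Inr b)
      then obtain w k where w: "pf_of m t = Inr (w, k)" by (cases b) auto
      from idx_InrD[OF t w] obtain z s where z: "z \<in> \<Omega>" "w = pt z s"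
        "s mod int m = int (comp_of t)" "1 \<le> k" "int k \<le> bnd z s" by metis
      obtain l where l: "k = Suc l" using z(4) by (cases k) auto
      have "ratH * inverse (lin w ^ k) = ratC w * inverse (lin w ^ k) + inverse (lin w ^ l)"
      proof -
        have "lin w * inverse (lin w ^ k) = inverse (lin w ^ l)" by (simp add: l)
        moreover have "ratH = ratC w + lin w" by (simp add: lin_def)
        ultimately show ?thesis by (metis distrib_right)
      qed
      then have "coef ratH \<odot>\<^bsub>N\<^esub> family_elem m \<beta> t
          = coef (ratC w) \<odot>\<^bsub>N\<^esub> uv (s mod int m) (inverse (lin (pt z s) ^ k))
            \<oplus>\<^bsub>N\<^esub> uv (s mod int m) (inverse (lin (pt z s) ^ l))"
        by (simp add: family_elem_uv[OF t] w uv_smult uv_add z(2,3))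
      moreover have "int l \<le> bnd z s" using z(5) l by simp
      ultimately show ?thesis
        using uv_inverse_in_span[OF z(1)] z(5) Sp by (simp add: csubspace_def)
    qed
    then show "family_elem m \<beta> t \<in> ?H" using family_carrier t by blast
  qed
  ultimately show ?thesis using span_least[of _ ?H] assms by blast
qed

lemma span_eq_L: "Sp = L"
proof
  show "Sp \<subseteq> L"
    using family_in_L by (intro span_least csubspace_L) blast
  show "L \<subseteq> Sp"
  proof (rule L_subset[OF csubspace_span[OF family_carrier] span_h_closed])
    fix z s assume z: "z \<in> \<Omega>"
    \<comment> \<open>The strongest pole that the family offers at this point attains the bound
      exactly.\<close>
    let ?b = "inverse (lin (pt z s) ^ nat (bnd z s))"
    have "uv (s mod int m) ?b \<in> Sp"
      by (rule uv_inverse_in_span[OF z]) (simp add: bnd_nonneg)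
    moreover have "pole_le (pt z s) (- bnd z s) (inverse ?b)"
      using pole_le_lin_powi[of "pt z s" "pt z s" "bnd z s"] bnd_nonneg[of z s]
      by (simp add: power_int_def)
    ultimately show "\<exists>b. b \<noteq> 0 \<and> uv (s mod int m) b \<in> Sp \<and> pole_le (pt z s) (- bnd z s) (inverse b)"
      by (intro exI[of _ ?b]) simp
  qed
qed

section \<open>Linear independence of the family\<close>

lemma family_independent:
  assumes F: "finite F" "F \<subseteq> idx" and sum: "(\<Oplus>\<^bsub>N\<^esub>t\<in>F. coef (ratC (d t)) \<odot>\<^bsub>N\<^esub> family_elem m \<beta> t) = \<zero>\<^bsub>N\<^esub>"
    and t: "t \<in> F"
  shows "d t = 0"
proof -
  have expand: "(\<Oplus>\<^bsub>N\<^esub>t\<in>F. coef (ratC (d t)) \<odot>\<^bsub>N\<^esub> family_elem m \<beta> t)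
      = el (\<lambda>i. \<Sum>t\<in>F. if i = int (comp_of t) then ratC (d t) * partial_fraction (pf_of m t) else 0)"
    using F
  proof (induction F rule: finite_induct)
    case empty
    then show ?case by (simp add: zero_N_el)
  next
    case (insert t F)
    have "coef (ratC (d t)) \<odot>\<^bsub>N\<^esub> family_elem m \<beta> t \<in> carrier N" if "t \<in> idx" for t
      using that by (simp add: family_elem_uv uv_smult)
    then have "(\<Oplus>\<^bsub>N\<^esub>t\<in>insert t F. coef (ratC (d t)) \<odot>\<^bsub>N\<^esub> family_elem m \<beta> t)
        = coef (ratC (d t)) \<odot>\<^bsub>N\<^esub> family_elem m \<beta> t \<oplus>\<^bsub>N\<^esub> (\<Oplus>\<^bsub>N\<^esub>t\<in>F. coef (ratC (d t)) \<odot>\<^bsub>N\<^esub> family_elem m \<beta> t)"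
      using insert by (intro N.M.finsum_insert) auto
    also have "coef (ratC (d t)) \<odot>\<^bsub>N\<^esub> family_elem m \<beta> t
        = el (\<lambda>i. if i = int (comp_of t) then ratC (d t) * partial_fraction (pf_of m t) else 0)"
      using insert by (simp add: family_elem_uv uv_smult) (simp add: uv_def)
    finally show ?case using insert by (simp add: el_add)
  qed
  have zero: "(\<Sum>t\<in>F. if i = int (comp_of t) then ratC (d t) * partial_fraction (pf_of m t) else 0) = 0"
    if "0 \<le> i" "i < int m" for i
    using trans[OF expand[symmetric] sum] that unfolding el_eq_0_iff by blast
  \<comment> \<open>Relations split by component; within one component distinct indices have
    distinct partial fractions by \<open>idx_inj\<close>.\<close>
  define G where "G = {t' \<in> F. comp_of t' = comp_of t}"
  have inj: "inj_on (pf_of m) G"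
    using F by (intro inj_onI idx_inj) (auto simp: G_def)
  have G: "finite G" "t \<in> G" using F t by (auto simp: G_def)
  have "(\<Sum>p\<in>pf_of m ` G. ratC (d (the_inv_into G (pf_of m) p)) * partial_fraction p)
      = (\<Sum>t'\<in>G. ratC (d t') * partial_fraction (pf_of m t'))"
    by (simp add: sum.reindex[OF inj] the_inv_into_f_f[OF inj])
  also have "\<dots> = (\<Sum>t'\<in>F. if int (comp_of t) = int (comp_of t')
      then ratC (d t') * partial_fraction (pf_of m t') else 0)"
    unfolding G_def using F(1) by (intro sum.mono_neutral_cong_left) auto
  also have "\<dots> = 0"
    using comp_less[of t] F t by (intro zero) auto
  finally have "d (the_inv_into G (pf_of m) (pf_of m t)) = 0"
  proof (rule partial_fractions_independent[rotated 2])
    show "Inr (z, 0) \<notin> pf_of m ` G" for z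
    proof
      assume "Inr (z, 0) \<in> pf_of m ` G"
      then obtain t' where "t' \<in> idx" "pf_of m t' = Inr (z, 0)" using F by (auto simp: G_def)
      from idx_InrD[OF this] show False by auto
    qed
  qed (use G in auto)
  then show ?thesis using G by (simp add: the_inv_into_f_f[OF inj])
qed

text \<open>Two equal members would satisfy a relation with coefficients 1 and -1. This is needed
  because \<open>V.lin_dep\<close> speaks of the image set, which does not see repetitions.\<close>

lemma family_inj: "inj_on (family_elem m \<beta>) idx"
proof (rule inj_onI, rule ccontr)
  fix t t' assume t: "t \<in> idx" "t' \<in> idx" "family_elem m \<beta> t = family_elem m \<beta> t'" and neq: "t \<noteq> t'"
  let ?d = "\<lambda>u. if u = t then 1 else - 1 :: complex"
  have c: "coef (ratC d) \<odot>\<^bsub>N\<^esub> family_elem m \<beta> t \<in> carrier N" if "t \<in> idx" for d t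
    using that by (simp add: family_elem_uv uv_smult)
  let ?f = "\<lambda>u. coef (ratC (?d u)) \<odot>\<^bsub>N\<^esub> family_elem m \<beta> u"
  have "(\<Oplus>\<^bsub>N\<^esub>u\<in>{t, t'}. ?f u) = ?f t \<oplus>\<^bsub>N\<^esub> (\<Oplus>\<^bsub>N\<^esub>u\<in>{t'}. ?f u)"
    using neq c[OF t(1)] c[OF t(1), of 1] c[OF t(2)] by (intro N.M.finsum_insert) auto
  also have "(\<Oplus>\<^bsub>N\<^esub>u\<in>{t'}. ?f u) = ?f t' \<oplus>\<^bsub>N\<^esub> (\<Oplus>\<^bsub>N\<^esub>u\<in>{}. ?f u)"
    using c[OF t(2)] by (intro N.M.finsum_insert) auto
  also have "?f t \<oplus>\<^bsub>N\<^esub> \<dots> = \<zero>\<^bsub>N\<^esub>"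
    using neq by (simp add: t(3)[symmetric] family_elem_uv[OF t(1)] uv_smult uv_add uv_zero ratC_uminus)
  finally have sum: "(\<Oplus>\<^bsub>N\<^esub>u\<in>{t, t'}. ?f u) = \<zero>\<^bsub>N\<^esub>" .
  have "?d t = 0"
  proof (rule family_independent[where F = "{t, t'}" and d = ?d and t = t])
    show "(\<Oplus>\<^bsub>N\<^esub>u\<in>{t, t'}. ?f u) = \<zero>\<^bsub>N\<^esub>" by (fact sum)
  qed (use t in simp_all)
  then show False by simp
qed

lemma family_not_lin_dep: "\<not> V.lin_dep (family_elem m \<beta> ` idx)"
proof
  assume "V.lin_dep (family_elem m \<beta> ` idx)"
  then obtain A a v where A: "finite A" "A \<subseteq> family_elem m \<beta> ` idx" "V.lincomb a A = \<zero>\<^bsub>N\<^esub>" "v \<in> A" "a v \<noteq> 0"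
    unfolding V.lin_dep_def by (auto simp: class_ring_simps)
  obtain F where F: "F \<subseteq> idx" "A = family_elem m \<beta> ` F" using A(2) by (auto simp: subset_image_iff)
  have inj: "inj_on (family_elem m \<beta>) F" using family_inj F(1) by (rule inj_on_subset)
  have finF: "finite F" using A(1) F(2) finite_image_iff[OF inj] by simp
  \<comment> \<open>Finite sums involve only the additive structure, which \<open>cspace N\<close>
    shares with \<open>N\<close>.\<close>
  have "(\<Oplus>\<^bsub>cspace N\<^esub>v\<in>A. coef (ratC (a v)) \<odot>\<^bsub>N\<^esub> v) = (\<Oplus>\<^bsub>N\<^esub>v\<in>A. coef (ratC (a v)) \<odot>\<^bsub>N\<^esub> v)"
    by (simp add: finsum_def finprod_def)
  then have zero: "(\<Oplus>\<^bsub>N\<^esub>v\<in>A. coef (ratC (a v)) \<odot>\<^bsub>N\<^esub> v) = \<zero>\<^bsub>N\<^esub>"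
    using A(3) by (simp add: V.lincomb_def)
  have reindex: "(\<Oplus>\<^bsub>N\<^esub>v\<in>A. coef (ratC (a v)) \<odot>\<^bsub>N\<^esub> v)
      = (\<Oplus>\<^bsub>N\<^esub>t\<in>F. coef (ratC (a (family_elem m \<beta> t))) \<odot>\<^bsub>N\<^esub> family_elem m \<beta> t)"
    unfolding F(2)
  proof (rule N.M.finsum_reindex[OF _ inj])
    show "(\<lambda>v. coef (ratC (a v)) \<odot>\<^bsub>N\<^esub> v) \<in> family_elem m \<beta> ` F \<rightarrow> carrier N"
      using F(1) by (auto simp: family_elem_uv uv_smult)
  qed
  obtain t where t: "t \<in> F" "v = family_elem m \<beta> t" using A(4) F(2) by auto
  have "a (family_elem m \<beta> t) = 0"
    by (rule family_independent[OF finF F(1) trans[OF reindex[symmetric] zero] t(1)])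
  then show False using A(5) t(2) by simp
qed

end

theorem theoremB:
  fixes m :: nat and \<theta> r1 r2 c :: complex and \<omega> :: real
    and \<zeta> :: "nat \<Rightarrow> complex \<Rightarrow> int" and \<beta> :: ratfun and \<mu> :: "complex \<Rightarrow> int"
  assumes "m > 0"
    and "ratC \<theta> - (ratH + 1)^2 = - ((ratH - ratC r1) * (ratH - ratC r2))"
    and "Re r1 < \<omega>" and "Re r2 < \<omega>"
    and "(c, \<zeta>) \<in> Psi \<omega> m"
    and "\<beta> = g_fun \<omega> m (c, \<zeta>)"
    and "finite {z\<in>Omega_m \<omega> m. \<mu> z \<noteq> 0}"
    and "\<beta> = ratC c * (\<Prod>z\<in>{z\<in>Omega_m \<omega> m. \<mu> z \<noteq> 0}. (ratH - ratC z) powi \<mu> z)"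
    and "simple_left_module skew_laurent (N_mod m \<beta>)"
  shows "LinearCombinations.module.span class_ring (cspace (N_mod m \<beta>))
           (family_elem m \<beta> ` family_indices \<omega> m r1 r2 \<mu>) = sl2_socle \<theta> (N_mod m \<beta>)
    \<and> inj_on (family_elem m \<beta>) (family_indices \<omega> m r1 r2 \<mu>)
    \<and> \<not> LinearCombinations.module.lin_dep class_ring (cspace (N_mod m \<beta>))
           (family_elem m \<beta> ` family_indices \<omega> m r1 r2 \<mu>)"
proof -
  have c: "c \<noteq> 0" using assms(5) by (simp add: Psi_def)
  have \<beta>: "\<beta> = ratC c * (\<Prod>z\<in>{z\<in>Omega_m \<omega> m. \<mu> z \<noteq> 0}. lin z powi \<mu> z)"
    using assms(8) by (simp add: lin_def)
  then have "\<beta> \<noteq> 0" using c assms(7) by (simp add: power_int_eq_0_iff)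
  then interpret socle_setup m \<beta> \<omega> r1 r2 \<theta> c \<mu>
    using assms(1-4,7) c \<beta> by unfold_locales (simp_all add: lin_def)
  show ?thesis
    using span_eq_L socle_eq_L[OF assms(9)] family_inj family_not_lin_dep by simp
qed

end
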